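(* Let $1<p,q<\infty$ with $\frac1p+\frac1q=1$. Let $\Omega\subset\mathbb R^n$ ($n\ge2$) be a bounded domain with a tree covering $\{U_t\}_{t\in\Gamma}$ (with root $a$, $\Gamma^*=\Gamma\setminus\{a\}$ and associated sets $\{B_t\}_{t\in\Gamma^*}$) such that, for some constant, $\frac{|U_t|}{|B_t|}\le C$ for every $t\in\Gamma^*$. Let $\nu,\omega:\Omega\to\mathbb R$ be admissible weights subordinate to $\{U_t\}_{t\in\Gamma}$, with $\omega^p\in L^1(\Omega)$, such that $L^q(\Omega,\omega^{-q})\hookrightarrow L^q(\Omega,\nu^{-q})$ (continuous embedding) and such that the following weighted discrete Hardy inequality holds: there is a constant $C$ such that for all nonnegative $\{b_t\}_{t\in\Gamma^*}$ $$\left(\sum_{t\in\Gamma^*} |B_t|^{-q/p}\, \nu_t^{-q}\Big(\sum_{s\succeq t} b_s\Big)^q \right)^{\frac{1}{q}} \leq C \left(\sum_{t\in\Gamma^*} |B_t|^{-q/p}\, \omega_t^{-q}\, b_t^q\right)^{\frac{1}{q}},$$ where $\omega_t=\operatorname{ess\,inf}_{x\in B_t}\omega(x)$ and $\nu_t=\operatorname{ess\,inf}_{x\in B_t}\nu(x)$. Then there is a constant $C$ such that for every $g\in L^q(\Omega,\omega^{-q})$ with $\int_\Omega g=0$ there exists a $\mathcal C$-decomposition $\{g_t\}_{t\in\Gamma}$ of $g$ subordinate to $\{U_t\}_{t\in\Gamma}$ such that $$\sum_{t\in\Gamma} \int_{U_t}|g_t(x)|^q \nu^{-q}(x)\,dx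 \leq C \int_{\Omega} |g(x)|^q \omega^{-q}(x)\,dx.$$
   Context: A weight on $\Omega$ is a Lebesgue-measurable function $\eta:\Omega\to\mathbb R$ that is positive a.e.; $\|f\|_{L^q(\Omega,\eta)}=\left(\int_\Omega|f|^q\eta\right)^{1/q}$. Rooted trees: a rooted tree is a connected graph without cycles with a designated root $a$; every vertex is assumed to have finitely many children. $s\preceq t$ means that the unique path from $t$ to $a$ passes through $s$; the parent $t_p$ of $t\neq a$ is the vertex adjacent to $t$ on the path to the root. Open covering: a collection $\{U_t\}_{t\in\Gamma}$ of open subsets of $\Omega$ covering $\Omega$ up to a Lebesgue-null set and such that each $U_t$ intersects only finitely many $U_s$, $s\in\Gamma$. Tree covering: an open covering $\{U_t\}_{t\in\Gamma}$ of $\Omega$ such that (1) $\chi_\Omega(x)\le\sum_{t\in\Gamma}\chi_{U_t}(x)\le N\chi_\Omega(x)$ for a.e. $x\in\Omega$, for some $N\ge1$; (2) $\Gamma$ is the set of vertices of a rooted tree with root $a$; (3) there is a collection $\{B_t\}_{t\ne a}$ of pairwise disjoint open sets with $B_t\subseteq U_t\cap U_{t_p}$. Admissible weight (subordinate to $\{U_t\}$): a weight $\eta$ for which there is a constant $C$ with $\operatorname{ess\,sup}_{U_t}\eta\le C\operatorname{ess\,inf}_{U_t}\eta$ for all $t\in\Gamma$. $\mathcal C$-decomposition: for $g\in L^1(\Omega)$ with $\int_\Omega g=0$, a $\mathcal C$-decomposition of $g$ subordinate to an open covering $\{U_t\}_{t\in\Gamma}$ is a collection $\{g_t\}_{t\in\Gamma}\subset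 L^1(\Omega)$ with (1) $g=\sum_{t\in\Gamma}g_t$; (2) $\operatorname{supp}(g_t)\subset U_t$, in the sense that $g_t=0$ a.e. outside $U_t$; (3) $\int_{U_t}g_t=0$ for all $t\in\Gamma$. (Under the hypotheses, $L^q(\Omega,\omega^{-q})\subset L^1(\Omega)$.) *)

theory Defs
  imports "HOL-Analysis.Analysis" "HOL-Probability.Essential_Supremum"
begin

(* Rooted trees: an undirected graph is a vertex set V with an adjacency relation E.
   Graph_Theory.Digraph_Component.tree is not usable here: it excludes directed cycles only,
   so a symmetric edge u-v counts as a cycle and a directed diamond counts as a tree. *)

definition graph_path :: "'t set \<Rightarrow> ('t \<Rightarrow> 't \<Rightarrow> bool) \<Rightarrow> 't list \<Rightarrow> 't \<Rightarrow> 't \<Rightarrow> bool" where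
  "graph_path V E p u v \<longleftrightarrow>
     p \<noteq> [] \<and> hd p = u \<and> last p = v \<and> set p \<subseteq> V \<and> distinct p \<and> successively E p"

definition graph_cycle :: "'t set \<Rightarrow> ('t \<Rightarrow> 't \<Rightarrow> bool) \<Rightarrow> 't list \<Rightarrow> bool" where
  "graph_cycle V E p \<longleftrightarrow>
     3 \<le> length p \<and> set p \<subseteq> V \<and> distinct p \<and> successively E p \<and> E (last p) (hd p)"

(* the unique path from t to the root a; only meaningful in a tree and for t in V *)
definition root_path :: "'t set \<Rightarrow> ('t \<Rightarrow> 't \<Rightarrow> bool) \<Rightarrow> 't \<Rightarrow> 't \<Rightarrow> 't list" where
  "root_path V E a t = (THE p. graph_path V E p t a)"

definition tree_le :: "'t set \<Rightarrow> ('t \<Rightarrow> 't \<Rightarrow> bool) \<Rightarrow> 't \<Rightarrow> 't \<Rightarrow> 't \<Rightarrow> bool" where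
  "tree_le V E a s t \<longleftrightarrow> s \<in> set (root_path V E a t)"

(* the path starts at t itself, so its entry 1 is the neighbour of t towards the root;
   only meaningful for t distinct from a *)
definition tree_parent :: "'t set \<Rightarrow> ('t \<Rightarrow> 't \<Rightarrow> bool) \<Rightarrow> 't \<Rightarrow> 't \<Rightarrow> 't" where
  "tree_parent V E a t = root_path V E a t ! 1"

definition rooted_tree :: "'t set \<Rightarrow> ('t \<Rightarrow> 't \<Rightarrow> bool) \<Rightarrow> 't \<Rightarrow> bool" where
  "rooted_tree V E a \<longleftrightarrow>
     a \<in> V \<and>
     (\<forall>u\<in>V. \<not> E u u) \<and> (\<forall>u\<in>V. \<forall>v\<in>V. E u v \<longrightarrow> E v u) \<and>
     (\<forall>u\<in>V. \<forall>v\<in>V. \<exists>p. graph_path V E p u v) \<and>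
     (\<nexists>p. graph_cycle V E p) \<and>
     (\<forall>t\<in>V. finite {s \<in> V - {a}. tree_parent V E a s = t})"

definition open_covering :: "'a::euclidean_space set \<Rightarrow> 't set \<Rightarrow> ('t \<Rightarrow> 'a set) \<Rightarrow> bool" where
  "open_covering \<Omega> \<Gamma> U \<longleftrightarrow>
     (\<forall>t\<in>\<Gamma>. open (U t) \<and> U t \<subseteq> \<Omega>) \<and>
     \<Omega> - (\<Union>t\<in>\<Gamma>. U t) \<in> null_sets lebesgue \<and>
     (\<forall>t\<in>\<Gamma>. finite {s \<in> \<Gamma>. U t \<inter> U s \<noteq> {}})"

definition tree_covering ::
  "'a::euclidean_space set \<Rightarrow> 't set \<Rightarrow> ('t \<Rightarrow> 't \<Rightarrow> bool) \<Rightarrow> 't \<Rightarrow>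
   ('t \<Rightarrow> 'a set) \<Rightarrow> ('t \<Rightarrow> 'a set) \<Rightarrow> bool" where
  "tree_covering \<Omega> \<Gamma> E a U B \<longleftrightarrow>
     open_covering \<Omega> \<Gamma> U \<and>
     (\<exists>N::real. 1 \<le> N \<and>
        (AE x in lebesgue_on \<Omega>.
           (indicator \<Omega> x :: ennreal) \<le> (\<Sum>\<^sub>\<infinity>t\<in>\<Gamma>. indicator (U t) x) \<and>
           (\<Sum>\<^sub>\<infinity>t\<in>\<Gamma>. indicator (U t) x) \<le> ennreal N * indicator \<Omega> x)) \<and>
     rooted_tree \<Gamma> E a \<and>
     disjoint_family_on B (\<Gamma> - {a}) \<and>
     (\<forall>t\<in>\<Gamma> - {a}. open (B t) \<and> B t \<subseteq> U t \<inter> U (tree_parent \<Gamma> E a t))"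

definition weight_on :: "'a::euclidean_space set \<Rightarrow> ('a \<Rightarrow> real) \<Rightarrow> bool" where
  "weight_on \<Omega> \<eta> \<longleftrightarrow>
     \<eta> \<in> borel_measurable (lebesgue_on \<Omega>) \<and> (AE x in lebesgue_on \<Omega>. 0 < \<eta> x)"

definition ess_sup_on :: "'a::euclidean_space set \<Rightarrow> ('a \<Rightarrow> real) \<Rightarrow> ereal" where
  "ess_sup_on S f = esssup (lebesgue_on S) (\<lambda>x. ereal (f x))"

definition ess_inf_on :: "'a::euclidean_space set \<Rightarrow> ('a \<Rightarrow> real) \<Rightarrow> ereal" where
  "ess_inf_on S f = - esssup (lebesgue_on S) (\<lambda>x. - ereal (f x))"

definition admissible_weight ::
  "'a::euclidean_space set \<Rightarrow> 't set \<Rightarrow> ('t \<Rightarrow> 'a set) \<Rightarrow> ('a \<Rightarrow> real) \<Rightarrow> bool" where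
  "admissible_weight \<Omega> \<Gamma> U \<eta> \<longleftrightarrow>
     weight_on \<Omega> \<eta> \<and>
     (\<exists>C::real. \<forall>t\<in>\<Gamma>. ess_sup_on (U t) \<eta> \<le> ereal C * ess_inf_on (U t) \<eta>)"

definition weighted_Lq :: "'a::euclidean_space set \<Rightarrow> real \<Rightarrow> ('a \<Rightarrow> real) \<Rightarrow> ('a \<Rightarrow> real) set" where
  "weighted_Lq \<Omega> q \<eta> =
     {f \<in> borel_measurable (lebesgue_on \<Omega>).
        integrable (lebesgue_on \<Omega>) (\<lambda>x. \<bar>f x\<bar> powr q * \<eta> x)}"

definition weighted_Lq_norm ::
  "'a::euclidean_space set \<Rightarrow> real \<Rightarrow> ('a \<Rightarrow> real) \<Rightarrow> ('a \<Rightarrow> real) \<Rightarrow> real" where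
  "weighted_Lq_norm \<Omega> q \<eta> f = (LINT x|lebesgue_on \<Omega>. \<bar>f x\<bar> powr q * \<eta> x) powr (1 / q)"

definition continuously_embedded_Lq ::
  "'a::euclidean_space set \<Rightarrow> real \<Rightarrow> ('a \<Rightarrow> real) \<Rightarrow> ('a \<Rightarrow> real) \<Rightarrow> bool" where
  "continuously_embedded_Lq \<Omega> q \<eta> \<eta>' \<longleftrightarrow>
     weighted_Lq \<Omega> q \<eta> \<subseteq> weighted_Lq \<Omega> q \<eta>' \<and>
     (\<exists>C::real. \<forall>f\<in>weighted_Lq \<Omega> q \<eta>.
        weighted_Lq_norm \<Omega> q \<eta>' f \<le> C * weighted_Lq_norm \<Omega> q \<eta> f)"

(* positive real powers of extended nonnegative reals *)
definition ennreal_rpow :: "ennreal \<Rightarrow> real \<Rightarrow> ennreal" where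
  "ennreal_rpow x r = (if x = \<infinity> then \<infinity> else ennreal (enn2real x powr r))"

(* All sums are taken in the extended nonnegative reals: the right-hand side may be infinite,
   and the sum over the descendants s of t may diverge. The families W, W' stand for the
   weights in front of the powers on the left and on the right. *)
definition discrete_Hardy ::
  "'t set \<Rightarrow> ('t \<Rightarrow> 't \<Rightarrow> bool) \<Rightarrow> 't \<Rightarrow> real \<Rightarrow> ('t \<Rightarrow> real) \<Rightarrow> ('t \<Rightarrow> real) \<Rightarrow> bool" where
  "discrete_Hardy \<Gamma> E a q W W' \<longleftrightarrow>
     (\<exists>C::real. \<forall>b::'t \<Rightarrow> real. (\<forall>t\<in>\<Gamma> - {a}. 0 \<le> b t) \<longrightarrow>
        ennreal_rpow
          (\<Sum>\<^sub>\<infinity>t\<in>\<Gamma> - {a}. ennreal (W t) *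
             ennreal_rpow (\<Sum>\<^sub>\<infinity>s\<in>{s \<in> \<Gamma>. tree_le \<Gamma> E a t s}. ennreal (b s)) q) (1 / q)
        \<le> ennreal C *
          ennreal_rpow
            (\<Sum>\<^sub>\<infinity>t\<in>\<Gamma> - {a}. ennreal (W' t) * ennreal_rpow (ennreal (b t)) q) (1 / q))"

(* The sum in the second conjunct is understood pointwise almost everywhere. *)
definition C_decomposition ::
  "'a::euclidean_space set \<Rightarrow> 't set \<Rightarrow> ('t \<Rightarrow> 'a set) \<Rightarrow> ('a \<Rightarrow> real) \<Rightarrow> ('t \<Rightarrow> 'a \<Rightarrow> real) \<Rightarrow> bool" where
  "C_decomposition \<Omega> \<Gamma> U g h \<longleftrightarrow>
     (\<forall>t\<in>\<Gamma>. integrable (lebesgue_on \<Omega>) (h t)) \<and>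
     (AE x in lebesgue_on \<Omega>. ((\<lambda>t. h t x) has_sum g x) \<Gamma>) \<and>
     (\<forall>t\<in>\<Gamma>. AE x in lebesgue_on \<Omega>. x \<notin> U t \<longrightarrow> h t x = 0) \<and>
     (\<forall>t\<in>\<Gamma>. (LINT x|lebesgue_on (U t). h t x) = 0)"

end

theory Submission
  imports Defs
begin

text \<open>The sets \<open>X t \<subseteq> U t\<close> partition \<open>\<Omega>\<close> up to a null set, and \<open>g\<close> is first cut into the
  pieces \<open>g \<cdot> 1\<^bsub>X t\<^esub>\<close>. To make the means vanish, the integral \<open>m t\<close> of \<open>g\<close> over all pieces at or
  below \<open>t\<close> is moved from \<open>t\<close> to its parent by a multiple of the indicator of
  \<open>B t \<subseteq> U t \<inter> U t\<^sub>p\<close>; at the root what remains is the integral of \<open>g\<close>, which is 0. Since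
  the sets \<open>B t\<close> are disjoint, the weighted norms of the moved masses are at most
  \<open>\<Sum>t. |B t| powr (1 - q) * \<nu>\<^sub>t powr (-q) * |m t| powr q\<close>. As \<open>|m t|\<close> is at most the sum of
  \<open>\<integral>\<^bsub>X s\<^esub> |g|\<close> over \<open>s\<close> at or below \<open>t\<close>, the discrete Hardy inequality bounds this, and Hoelder's
  inequality on each \<open>U t\<close>, where \<open>\<omega>\<close> is comparable to \<open>\<omega>\<^sub>t\<close>, returns to the norm of \<open>g\<close>.\<close>

section \<open>Rooted trees\<close>

text \<open>Gives the \<open>THE\<close> in \<open>root_path\<close> a meaning. By induction along
  \<open>p\<close> it suffices that both paths take the same first step, since their tails are then
  paths with common ends.\<close>

lemma graph_path_unique:
  assumes irr: "\<And>u. u \<in> V \<Longrightarrow> \<not> E u u"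
    and sym: "\<And>u v. u \<in> V \<Longrightarrow> v \<in> V \<Longrightarrow> E u v \<Longrightarrow> E v u"
    and acyclic: "\<nexists>p. graph_cycle V E p"
    and "graph_path V E p u v" and "graph_path V E q u v"
  shows "p = q"
  using assms(4,5)
proof (induction p arbitrary: q u)
  case Nil
  then show ?case by (simp add: graph_path_def)
next
  case (Cons u' p')
  obtain q' where q: "q = u # q'"
    using Cons.prems(2) by (cases q) (auto simp: graph_path_def)
  have [simp]: "u' = u" using Cons.prems(1) by (simp add: graph_path_def)
  note P = Cons.prems[unfolded q graph_path_def]
  show ?case
  proof (cases "p' = [] \<or> q' = []")
    case True
    then have "p' = []" "q' = []"
      using P by (auto split: if_splits)
    then show ?thesis by (simp add: q)
  next
    case False
    then have ne: "p' \<noteq> []" "q' \<noteq> []" by auto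
    have pv: "graph_path V E p' (hd p') v" and qv: "graph_path V E q' (hd q') v"
      and Eu: "E u (hd p')" "E u (hd q')"
      using P ne by (auto simp: graph_path_def successively_Cons)
    \<comment> \<open>If the paths part at \<open>u\<close>, they first meet again at some \<open>z\<close>, which closes a cycle through \<open>u\<close>.\<close>
    have "hd p' = hd q'"
    proof (rule ccontr)
      assume neq: "hd p' \<noteq> hd q'"
      have "\<exists>x\<in>set p'. x \<in> set q'"
        using pv qv ne by (metis graph_path_def last_in_set)
      then obtain p1 z p2 where p': "p' = p1 @ z # p2" and z: "z \<in> set q'"
        and disj: "\<forall>y\<in>set p1. y \<notin> set q'"
        using split_list_first_prop[of p' "\<lambda>x. x \<in> set q'"] by blast
      obtain q1 q2 where q': "q' = q1 @ z # q2" using z by (meson split_list)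
      have V: "u \<in> V" "z \<in> V" "set p1 \<subseteq> V" "set q1 \<subseteq> V"
        using P by (auto simp: p' q')
      have succ_q: "successively E (q1 @ [z])"
        using qv by (auto simp: graph_path_def q' successively_append_iff)
      \<comment> \<open>Symmetry of \<open>E\<close> allows the second branch to be walked back from
        \<open>z\<close>, which closes the cycle.\<close>
      have "successively (\<lambda>x y. E y x) (q1 @ [z])"
        using succ_q by (rule successively_mono) (use V sym in \<open>auto simp: subset_iff\<close>)
      then have "successively E (z # rev q1)"
        by (metis rev.simps rev_append rev_singleton_conv append_Cons append_Nil successively_rev)
      moreover have "successively E (u # p1 @ [z])"
        using pv Eu(1) by (cases p1) (auto simp: graph_path_def p' successively_append_iff successively_Cons hd_append)
      ultimately have succ: "successively E (u # p1 @ z # rev q1)"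
        by (cases p1) (auto simp: successively_append_iff successively_Cons hd_append)
      \<comment> \<open>A cycle needs three vertices: if both branches were empty, both first steps
        would lead to \<open>z\<close>.\<close>
      have len: "p1 \<noteq> [] \<or> q1 \<noteq> []"
        using neq by (auto simp: p' q')
      have dist: "distinct (u # p1 @ z # rev q1)"
        using P disj by (auto simp: p' q')
      have "last (u # p1 @ z # rev q1) = hd q'"
        by (cases q1) (auto simp: q')
      moreover have "E (hd q') u"
        using Eu(2) sym V P ne by (metis hd_in_set list.set_intros(2) subsetD)
      ultimately have "graph_cycle V E (u # p1 @ z # rev q1)"
        using succ dist V len
        by (cases p1; cases q1) (auto simp: graph_cycle_def)
      then show False using acyclic by blast
    qed
    then show ?thesis using Cons.IH[OF pv] qv by (simp add: q)
  qed
qed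

lemma root_path_eq:
  assumes "rooted_tree V E a" and "graph_path V E p t a"
  shows "root_path V E a t = p"
  unfolding root_path_def
proof (rule the_equality)
  fix q assume "graph_path V E q t a"
  then show "q = p"
    by (rule graph_path_unique[rotated 3])
       (use assms in \<open>auto simp: rooted_tree_def\<close>)
qed (rule assms(2))

lemma graph_path_root_path:
  assumes "rooted_tree V E a" and "t \<in> V"
  shows "graph_path V E (root_path V E a t) t a"
proof -
  obtain p where p: "graph_path V E p t a"
    using assms unfolding rooted_tree_def by blast
  then show ?thesis using root_path_eq[OF assms(1) p] by simp
qed

text \<open>The tail of a root path from \<open>s\<close> on is itself a path to the root, so
  uniqueness identifies it. Statements about \<open>tree_le\<close> thus become statements about
  splitting one list.\<close>

lemma root_path_suffix:
  assumes "rooted_tree V E a" and "t \<in> V" and "root_path V E a t = xs @ s # ys"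
  shows "root_path V E a s = s # ys"
  by (rule root_path_eq[OF assms(1)])
     (use graph_path_root_path[OF assms(1,2)] in
        \<open>auto simp: assms(3) graph_path_def successively_append_iff\<close>)

lemma root_path_step:
  assumes T: "rooted_tree V E a" and t: "t \<in> V" "t \<noteq> a"
  shows "tree_parent V E a t \<in> V"
    and "root_path V E a t = t # root_path V E a (tree_parent V E a t)"
proof -
  note P = graph_path_root_path[OF T t(1), unfolded graph_path_def]
  obtain s ys where st: "root_path V E a t = t # s # ys"
    using P t(2) by (cases "root_path V E a t" rule: remdups_adj.cases) auto
  have par: "tree_parent V E a t = s" by (simp add: tree_parent_def st)
  show "tree_parent V E a t \<in> V" using P by (auto simp: st par)
  show "root_path V E a t = t # root_path V E a (tree_parent V E a t)"
    using root_path_suffix[OF T t(1), of "[t]" s ys] by (simp add: st par)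
qed

section \<open>Subtrees and their splitting at the children\<close>

definition subtree :: "'t set \<Rightarrow> ('t \<Rightarrow> 't \<Rightarrow> bool) \<Rightarrow> 't \<Rightarrow> 't \<Rightarrow> 't set" where
  "subtree V E a t = {s \<in> V. tree_le V E a t s}"

definition children :: "'t set \<Rightarrow> ('t \<Rightarrow> 't \<Rightarrow> bool) \<Rightarrow> 't \<Rightarrow> 't \<Rightarrow> 't set" where
  "children V E a t = {s \<in> V - {a}. tree_parent V E a s = t}"

lemma subtree_root:
  assumes "rooted_tree V E a"
  shows "subtree V E a a = V"
proof -
  have "a \<in> set (root_path V E a t)" if "t \<in> V" for t
    using graph_path_root_path[OF assms that] by (metis graph_path_def last_in_set)
  then show ?thesis by (auto simp: subtree_def tree_le_def)
qed

lemma root_path_child: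
  assumes "rooted_tree V E a" and "c \<in> children V E a t"
  shows "root_path V E a c = c # root_path V E a t"
  using root_path_step[of V E a c] assms by (auto simp: children_def)

lemma subtree_child_split:
  assumes T: "rooted_tree V E a" and c: "c \<in> children V E a t" and s: "s \<in> subtree V E a c"
  obtains xs where "root_path V E a s = xs @ c # root_path V E a t"
proof -
  obtain xs ys where xy: "root_path V E a s = xs @ c # ys"
    using s by (auto simp: subtree_def tree_le_def dest: split_list)
  have "root_path V E a c = c # ys"
    by (rule root_path_suffix[OF T _ xy]) (use s in \<open>auto simp: subtree_def\<close>)
  then show ?thesis using that xy root_path_child[OF T c] by simp
qed

lemma subtree_child_disjoint:
  assumes T: "rooted_tree V E a" and c: "c \<in> children V E a t" "d \<in> children V E a t" "c \<noteq> d"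
  shows "subtree V E a c \<inter> subtree V E a d = {}"
proof (rule ccontr)
  assume "\<not> ?thesis"
  then obtain s where s: "s \<in> subtree V E a c" "s \<in> subtree V E a d" by auto
  obtain xs where xs: "root_path V E a s = xs @ c # root_path V E a t"
    by (rule subtree_child_split[OF T c(1) s(1)])
  obtain ys where ys: "root_path V E a s = ys @ d # root_path V E a t"
    by (rule subtree_child_split[OF T c(2) s(2)])
  \<comment> \<open>The tails after \<open>c\<close> and after \<open>d\<close> agree, so both
    vertices occupy the same position of one list.\<close>
  have "length xs = length ys" using arg_cong[OF xs, of length] arg_cong[OF ys, of length] by simp
  then show False using xs ys c(3) by simp
qed

lemma notin_subtree_child:
  assumes T: "rooted_tree V E a" and c: "c \<in> children V E a t"
  shows "t \<notin> subtree V E a c"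
proof
  assume "t \<in> subtree V E a c"
  then obtain xs where "root_path V E a t = xs @ c # root_path V E a t"
    by (rule subtree_child_split[OF T c])
  then have "length (root_path V E a t) = length (xs @ c # root_path V E a t)" by simp
  then show False by simp
qed

text \<open>The vertex just before \<open>t\<close> on the root path of \<open>s\<close> is the
  child of \<open>t\<close> whose subtree contains \<open>s\<close>. This recursion drives the
  balance of masses in \<open>subtree_integral_step\<close>.\<close>

lemma subtree_eq:
  assumes T: "rooted_tree V E a" and t: "t \<in> V"
  shows "subtree V E a t = insert t (\<Union>c\<in>children V E a t. subtree V E a c)"
proof (intro equalityI subsetI)
  fix s assume s: "s \<in> subtree V E a t"
  then have sV: "s \<in> V" by (simp add: subtree_def)
  obtain xs ys where xy: "root_path V E a s = xs @ t # ys"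
    using s by (auto simp: subtree_def tree_le_def dest: split_list)
  have rt: "root_path V E a t = t # ys" by (rule root_path_suffix[OF T sV xy])
  note P = graph_path_root_path[OF T sV, unfolded graph_path_def]
  show "s \<in> insert t (\<Union>c\<in>children V E a t. subtree V E a c)"
  proof (cases xs rule: rev_cases)
    case Nil
    then show ?thesis using P xy by auto
  next
    case (snoc zs c)
    have rc: "root_path V E a c = c # t # ys"
      by (rule root_path_suffix[OF T sV, of zs]) (simp add: xy snoc)
    have "c \<in> V" using P xy snoc by auto
    \<comment> \<open>The root is the last entry of a path without repetitions, while
      \<open>t\<close> still follows \<open>c\<close>.\<close>
    moreover have "c \<noteq> a"
      using P by (auto simp: xy snoc split: if_splits)
    ultimately have "c \<in> children V E a t"
      by (simp add: children_def tree_parent_def rc)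
    moreover have "s \<in> subtree V E a c"
      using sV by (simp add: subtree_def tree_le_def xy snoc)
    ultimately show ?thesis by blast
  qed
next
  fix s assume "s \<in> insert t (\<Union>c\<in>children V E a t. subtree V E a c)"
  then consider "s = t" | c where "c \<in> children V E a t" "s \<in> subtree V E a c" by blast
  then show "s \<in> subtree V E a t"
  proof cases
    case 1
    then show ?thesis using graph_path_root_path[OF T t] t
      by (metis (mono_tags, lifting) graph_path_def hd_in_set mem_Collect_eq subtree_def tree_le_def)
  next
    case 2
    then obtain xs where "root_path V E a s = xs @ c # root_path V E a t"
      using subtree_child_split[OF T] by metis
    moreover have "t \<in> set (root_path V E a t)"
      using graph_path_root_path[OF T t] by (metis graph_path_def hd_in_set)
    ultimately show ?thesis using 2 by (simp add: subtree_def tree_le_def)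
  qed
qed

section \<open>Sums and powers of extended nonnegative reals\<close>

text \<open>Unordered sums become integrals over counting measure, from which they inherit
  additivity and scaling.\<close>

lemma nn_integral_count_space_eq_infsum:
  fixes f :: "'i \<Rightarrow> ennreal"
  assumes "countable A"
  shows "(\<integral>\<^sup>+i. f i \<partial>count_space A) = infsum f A"
proof (cases "finite A")
  case True
  then show ?thesis by (simp add: nn_integral_count_space_finite)
next
  case False
  then have bij: "bij_betw (from_nat_into A) UNIV A"
    by (rule bij_betw_from_nat_into[OF assms])
  have "(\<integral>\<^sup>+i. f i \<partial>count_space A) = (\<Sum>n. f (from_nat_into A n))"
    by (simp flip: nn_integral_bij_count_space[OF bij] nn_integral_count_space_nat)
  also have "\<dots> = (\<Sum>\<^sub>\<infinity>n. f (from_nat_into A n))"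
    by (intro sums_unique[symmetric] has_sum_imp_sums has_sum_infsum) (simp add: nonneg_summable_on_complete)
  also have "\<dots> = infsum f A" by (rule infsum_reindex_bij_betw[OF bij])
  finally show ?thesis .
qed

text \<open>This is countable additivity of the measure with density \<open>f\<close>.\<close>

lemma nn_integral_UN_eq_infsum:
  assumes "countable I" and sets: "\<And>i. i \<in> I \<Longrightarrow> X i \<in> sets M"
    and disj: "disjoint_family_on X I" and f [measurable]: "f \<in> borel_measurable M"
  shows "(\<integral>\<^sup>+x. f x * indicator (\<Union>i\<in>I. X i) x \<partial>M) = (\<Sum>\<^sub>\<infinity>i\<in>I. \<integral>\<^sup>+x. f x * indicator (X i) x \<partial>M)"
proof -
  have "(\<integral>\<^sup>+x. f x * indicator (\<Union>i\<in>I. X i) x \<partial>M) = emeasure (density M f) (\<Union>i\<in>I. X i)"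
    using assms(1) sets by (intro emeasure_density[symmetric]) auto
  also have "\<dots> = (\<integral>\<^sup>+i. emeasure (density M f) (X i) \<partial>count_space I)"
    using assms by (intro emeasure_UN_countable) auto
  also have "\<dots> = (\<Sum>\<^sub>\<infinity>i\<in>I. emeasure (density M f) (X i))"
    by (rule nn_integral_count_space_eq_infsum[OF assms(1)])
  also have "\<dots> = (\<Sum>\<^sub>\<infinity>i\<in>I. \<integral>\<^sup>+x. f x * indicator (X i) x \<partial>M)"
    by (rule infsum_cong) (simp add: emeasure_density sets)
  finally show ?thesis .
qed

lemma sum_le_infsum_ennreal:
  fixes f :: "'i \<Rightarrow> ennreal"
  assumes "finite F" and "F \<subseteq> A"
  shows "sum f F \<le> infsum f A"
proof -
  have "infsum f F \<le> infsum f A"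
    by (rule infsum_mono_neutral) (use assms in \<open>auto intro!: nonneg_summable_on_complete\<close>)
  then show ?thesis using assms by simp
qed

text \<open>Disjointness means that each \<open>f j\<close> is counted at most once; a bound on all
  finite partial sums is enough.\<close>

lemma infsum_sum_disjoint_le:
  fixes f :: "'j \<Rightarrow> ennreal"
  assumes fin: "\<And>i. i \<in> I \<Longrightarrow> finite (J i)" and sub: "\<And>i. i \<in> I \<Longrightarrow> J i \<subseteq> A"
    and disj: "disjoint_family_on J I"
  shows "(\<Sum>\<^sub>\<infinity>i\<in>I. \<Sum>j\<in>J i. f j) \<le> infsum f A"
proof (rule infsum_le_finite_sums)
  fix F assume F: "finite F" "F \<subseteq> I"
  have "(\<Sum>i\<in>F. \<Sum>j\<in>J i. f j) = sum f (\<Union>i\<in>F. J i)"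
  proof (rule sum.UNION_disjoint[symmetric])
    show "\<forall>i\<in>F. \<forall>j\<in>F. i \<noteq> j \<longrightarrow> J i \<inter> J j = {}"
      using disj F(2) unfolding disjoint_family_on_def by blast
  qed (use F fin in auto)
  also have "\<dots> \<le> infsum f A"
    using F fin sub by (intro sum_le_infsum_ennreal) auto
  finally show "(\<Sum>i\<in>F. \<Sum>j\<in>J i. f j) \<le> infsum f A" .
qed (simp add: nonneg_summable_on_complete)

section \<open>Real powers of extended nonnegative reals\<close>

lemma ennreal_rpow_ennreal: "0 \<le> x \<Longrightarrow> ennreal_rpow (ennreal x) r = ennreal (x powr r)"
  by (simp add: ennreal_rpow_def)

lemma ennreal_rpow_mono:
  assumes "x \<le> y" and "0 \<le> r"
  shows "ennreal_rpow x r \<le> ennreal_rpow y r"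
proof (cases "y = \<infinity>")
  case False
  then have "x \<noteq> \<infinity>" using assms by (auto simp: top_unique)
  moreover have "enn2real x \<le> enn2real y"
    using assms False by (intro enn2real_mono) (auto simp: less_top)
  ultimately show ?thesis
    using False assms by (auto simp: ennreal_rpow_def intro!: ennreal_leI powr_mono2)
qed (simp add: ennreal_rpow_def)

text \<open>Finiteness of \<open>Y\<close> makes the right-hand side finite, hence also
  \<open>X\<close>, and the inequality between reals can be raised to the power \<open>q\<close>.
  The absolute value covers a negative \<open>C\<close>, which \<open>ennreal\<close> truncates to
  zero.\<close>

lemma le_of_ennreal_rpow_inverse_le:
  assumes q: "0 < q" and Y: "Y < \<infinity>" and le: "ennreal_rpow X (1 / q) \<le> ennreal C * ennreal_rpow Y (1 / q)"
  shows "X \<le> ennreal (\<bar>C\<bar> powr q) * Y"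
proof -
  obtain y where y: "Y = ennreal y" "0 \<le> y" using Y by (cases Y) auto
  have "ennreal C * ennreal_rpow Y (1 / q) \<le> ennreal (\<bar>C\<bar> * y powr (1 / q))"
    using y by (auto simp: ennreal_rpow_ennreal ennreal_mult intro!: mult_right_mono ennreal_leI)
  with le have le': "ennreal_rpow X (1 / q) \<le> ennreal (\<bar>C\<bar> * y powr (1 / q))" by order
  then have "X \<noteq> \<infinity>" by (auto simp: ennreal_rpow_def top_unique)
  then obtain x where x: "X = ennreal x" "0 \<le> x" by (cases X) auto
  have "x powr (1 / q) \<le> \<bar>C\<bar> * y powr (1 / q)"
    using le' x by (simp add: ennreal_rpow_ennreal)
  then have "(x powr (1 / q)) powr q \<le> (\<bar>C\<bar> * y powr (1 / q)) powr q"
    using q by (intro powr_mono2) auto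
  then have "x \<le> \<bar>C\<bar> powr q * y"
    using q x y by (simp add: powr_powr powr_mult)
  then show ?thesis
    using x y by (simp flip: ennreal_mult)
qed

lemma add_powr_le:
  fixes x y q :: real
  assumes "0 \<le> x" "0 \<le> y" "0 \<le> q"
  shows "(x + y) powr q \<le> 2 powr q * (x powr q + y powr q)"
proof -
  have "(x + y) powr q \<le> (2 * max x y) powr q"
    using assms by (intro powr_mono2) auto
  also have "\<dots> = 2 powr q * max x y powr q" using assms by (simp add: powr_mult)
  also have "\<dots> \<le> 2 powr q * (x powr q + y powr q)"
    by (intro mult_left_mono) (auto simp: max_def)
  finally show ?thesis .
qed

text \<open>Hoelder's inequality for \<open>f\<close> against the constant 1 on \<open>A\<close>,
  with the measure of \<open>A\<close> replaced by an upper bound \<open>V\<close>. It comes from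
  integrating Young's inequality with one well-chosen constant.\<close>

lemma set_integral_powr_le:
  fixes f :: "'a \<Rightarrow> real" and p q V :: real
  assumes pq: "1 < p" "1 < q" "1 / p + 1 / q = 1"
    and [measurable]: "A \<in> sets M" and V: "emeasure M A \<le> ennreal V" "0 < V"
    and f: "integrable M f" "integrable M (\<lambda>x. indicator A x * \<bar>f x\<bar> powr q)"
  shows "(LINT x|M. indicator A x * \<bar>f x\<bar>) powr q
      \<le> V powr (q / p) * (LINT x|M. indicator A x * \<bar>f x\<bar> powr q)"
proof -
  have [measurable]: "f \<in> borel_measurable M" using f by simp
  define X where "X = (LINT x|M. indicator A x * \<bar>f x\<bar>)"
  define Y where "Y = (LINT x|M. indicator A x * \<bar>f x\<bar> powr q)"
  have Y0: "0 \<le> Y" and X0: "0 \<le> X" by (auto simp: X_def Y_def)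
  have fin: "emeasure M A < \<infinity>" using V by (auto simp: less_top[symmetric] top_unique)
  have mV: "measure M A \<le> V"
    using V by (simp add: measure_def enn2real_leI)
  \<comment> \<open>Young's inequality for \<open>|f x| * b\<close> is an equality where \<open>|f x|\<close> equals the mean \<open>X / V\<close>.\<close>
  define b where "b = (X / V) powr (q - 1)"
  have b0: "0 \<le> b" by (simp add: b_def)
  have qp: "q / p = q - 1" and qp': "(q - 1) * p = q" using pq by (auto simp: field_simps)
  have bp: "b powr p = (X / V) powr q" by (simp add: b_def powr_powr qp')
  have intf: "integrable M (\<lambda>x. indicator A x * \<bar>f x\<bar>)"
    by (rule Bochner_Integration.integrable_bound[OF f(1)]) (auto simp: indicator_def)
  have "X * b = (LINT x|M. indicator A x * \<bar>f x\<bar> * b)"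
    by (simp add: X_def)
  also have "\<dots> \<le> (LINT x|M. indicator A x * \<bar>f x\<bar> powr q / q + indicator A x * (b powr p / p))"
  proof (rule integral_mono)
    show "integrable M (\<lambda>x. indicator A x * \<bar>f x\<bar> powr q / q + indicator A x * (b powr p / p))"
      using f fin by (intro Bochner_Integration.integrable_add integrable_divide integrable_mult_left integrable_real_indicator) auto
    fix x show "indicator A x * \<bar>f x\<bar> * b \<le> indicator A x * \<bar>f x\<bar> powr q / q + indicator A x * (b powr p / p)"
      using Youngs_inequality[of q p "\<bar>f x\<bar>" b] pq b0 by (auto simp: indicator_def)
  qed (use intf in auto)
  also have "\<dots> = Y / q + measure M A * (b powr p / p)"
    using f fin by (subst Bochner_Integration.integral_add) (auto simp: Y_def intro!: integrable_real_indicator)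
  also have "\<dots> \<le> Y / q + V * (b powr p / p)"
    using mV pq by (intro add_left_mono mult_right_mono) auto
  finally have main: "X * b \<le> Y / q + V * (X / V) powr q / p" by (simp add: bp)
  show ?thesis
  proof (cases "X = 0")
    case True
    then show ?thesis using Y0 by (simp flip: X_def Y_def)
  next
    case False
    then have X: "0 < X" using X0 by simp
    \<comment> \<open>By the choice of \<open>b\<close>, the second Young term is the fraction
      \<open>1 / p\<close> of the left-hand side and can be absorbed there, which leaves the
      fraction \<open>1 / q\<close> on both sides.\<close>
    have 1: "V * (X / V) powr q = X * b"
      using X V(2) by (simp add: b_def powr_diff)
    have "X * b * (1 - 1 / p) \<le> Y / q" using main unfolding 1 by (simp add: algebra_simps)
    also have "1 - 1 / p = 1 / q" using pq by simp
    finally have "X * b \<le> Y" using pq by (simp add: divide_le_cancel)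
    moreover have "X * b = X powr q / V powr (q - 1)"
      using X V(2) by (simp add: b_def powr_divide powr_diff)
    ultimately show ?thesis
      using V(2) unfolding qp X_def[symmetric] Y_def[symmetric]
      by (simp add: divide_le_eq mult.commute)
  qed
qed

section \<open>Essential bounds of admissible weights\<close>

lemma AE_lebesgue_on_open_subset:
  assumes "open S" and "S \<subseteq> \<Omega>" and "open \<Omega>"
  shows "(AE x in lebesgue_on S. P x) \<longleftrightarrow> (AE x in lebesgue_on \<Omega>. x \<in> S \<longrightarrow> P x)"
proof -
  have "(AE x in lebesgue_on S. P x) \<longleftrightarrow> (AE x in lebesgue. x \<in> S \<longrightarrow> P x)"
    using assms by (intro AE_restrict_space_iff) auto
  also have "\<dots> \<longleftrightarrow> (AE x in lebesgue. x \<in> \<Omega> \<longrightarrow> x \<in> S \<longrightarrow> P x)"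
    using assms(2) by (intro AE_cong) auto
  also have "\<dots> \<longleftrightarrow> (AE x in lebesgue_on \<Omega>. x \<in> S \<longrightarrow> P x)"
    using assms by (intro AE_restrict_space_iff[symmetric]) auto
  finally show ?thesis .
qed

text \<open>A nonempty open set is not a null set. Evaluating essential bounds at such a point shows
  that they are finite or positive.\<close>

lemma AE_lebesgue_on_open_witness:
  fixes S :: "'a::euclidean_space set"
  assumes "open S" and "S \<noteq> {}" and "AE x in lebesgue_on S. P x"
  obtains x where "x \<in> S" and "P x"
proof -
  have "\<exists>x\<in>S. P x"
  proof (rule ccontr)
    assume "\<not> ?thesis"
    with assms(3) have "AE x in lebesgue. x \<notin> S"
      using assms(1) by (subst (asm) AE_restrict_space_iff) (auto elim!: eventually_mono)
    then have "S \<in> null_sets lebesgue"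
      using assms(1) by (subst AE_iff_null_sets) auto
    then show False
      using open_not_negligible[OF assms(1,2)] by (simp add: negligible_iff_null_sets)
  qed
  then show ?thesis using that by blast
qed

lemma ess_sup_on_AE: "AE x in lebesgue_on S. ereal (f x) \<le> ess_sup_on S f"
  unfolding ess_sup_on_def by (rule esssup_AE)

lemma ess_inf_on_AE: "AE x in lebesgue_on S. ess_inf_on S f \<le> ereal (f x)"
  using esssup_AE[of "\<lambda>x. - ereal (f x)" "lebesgue_on S"]
  unfolding ess_inf_on_def by eventually_elim (simp add: ereal_uminus_le_reorder)

lemma ess_inf_on_greatest:
  assumes [measurable]: "f \<in> borel_measurable (lebesgue_on S)" and "AE x in lebesgue_on S. c \<le> ereal (f x)"
  shows "c \<le> ess_inf_on S f"
proof -
  have "esssup (lebesgue_on S) (\<lambda>x. - ereal (f x)) \<le> - c"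
    using assms(2) by (intro esssup_I) (auto simp only: ereal_minus_le_minus assms borel_measurable_uminus_ereal borel_measurable_ereal)
  then show ?thesis unfolding ess_inf_on_def by (metis ereal_minus_le_minus ereal_uminus_uminus)
qed

text \<open>Passing from \<open>U t\<close> to a smaller \<open>S\<close> only raises the essential
  infimum, so the constant of admissibility compares the weight on all of \<open>U t\<close> with
  its infimum over \<open>S\<close>, later \<open>B t\<close>. Since \<open>real_of_ereal\<close>
  sends infinite values to 0, the positivity claim also says that this infimum is finite.\<close>

lemma admissible_weight_bounds:
  fixes \<Omega> :: "'a::euclidean_space set"
  assumes \<Omega>: "open \<Omega>" and cov: "open_covering \<Omega> \<Gamma> U" and adm: "admissible_weight \<Omega> \<Gamma> U \<eta>"
  shows "\<exists>K>0. \<forall>t\<in>\<Gamma>. \<forall>S. open S \<longrightarrow> S \<noteq> {} \<longrightarrow> S \<subseteq> U t \<longrightarrow>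
      0 < real_of_ereal (ess_inf_on S \<eta>) \<and>
      (AE x in lebesgue_on \<Omega>. x \<in> S \<longrightarrow> real_of_ereal (ess_inf_on S \<eta>) \<le> \<eta> x) \<and>
      (AE x in lebesgue_on \<Omega>. x \<in> U t \<longrightarrow> \<eta> x \<le> K * real_of_ereal (ess_inf_on S \<eta>))"
proof -
  obtain C where C: "\<And>t. t \<in> \<Gamma> \<Longrightarrow> ess_sup_on (U t) \<eta> \<le> ereal C * ess_inf_on (U t) \<eta>"
    using adm by (auto simp: admissible_weight_def)
  have meas: "\<eta> \<in> borel_measurable (lebesgue_on S)" if "S \<subseteq> \<Omega>" for S
    using adm that by (auto simp: admissible_weight_def weight_on_def intro: measurable_restrict_mono)
  have pos: "AE x in lebesgue_on S. 0 < \<eta> x" if "open S" "S \<subseteq> \<Omega>" for S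
    using adm by (auto simp: admissible_weight_def weight_on_def AE_lebesgue_on_open_subset[OF that \<Omega>])
  show ?thesis
  \<comment> \<open>The maximum with 1 makes the constant positive at once; \<open>C\<close> itself
    is seen to be positive only inside a nonempty \<open>U t\<close>.\<close>
  proof (intro exI[of _ "max C 1"] conjI[of "0 < max C 1"] ballI allI impI)
    fix t S assume t: "t \<in> \<Gamma>" and S: "open S" "S \<noteq> {}" "S \<subseteq> U t"
    have U: "open (U t)" "U t \<subseteq> \<Omega>" "U t \<noteq> {}" using cov t S by (auto simp: open_covering_def)
    then have S\<Omega>: "S \<subseteq> \<Omega>" using S by auto
    have "AE x in lebesgue_on (U t). 0 < \<eta> x \<and> ereal (\<eta> x) \<le> ess_sup_on (U t) \<eta> \<and> ess_inf_on (U t) \<eta> \<le> ereal (\<eta> x)"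
      using pos[OF U(1,2)] ess_sup_on_AE[where S="U t" and f=\<eta>] ess_inf_on_AE[where S="U t" and f=\<eta>] by eventually_elim auto
    then obtain x where x: "0 < \<eta> x" "ereal (\<eta> x) \<le> ess_sup_on (U t) \<eta>" "ess_inf_on (U t) \<eta> \<le> ereal (\<eta> x)"
      by (rule AE_lebesgue_on_open_witness[OF U(1,3)]) auto
    have "0 \<le> ess_inf_on (U t) \<eta>"
      by (intro ess_inf_on_greatest meas U eventually_mono[OF pos[OF U(1,2)]]) auto
    then obtain i where i: "ess_inf_on (U t) \<eta> = ereal i" "0 \<le> i"
      using x(3) by (cases "ess_inf_on (U t) \<eta>") auto
    have Ci: "ess_sup_on (U t) \<eta> \<le> ereal (C * i)" using C[OF t] i by simp
    have "ereal (\<eta> x) \<le> ereal (C * i)" using x(2) Ci by order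
    \<comment> \<open>A single point with positive weight below the essential supremum prevents the
      essential infimum \<open>i\<close> from being 0.\<close>
    then have "0 < C * i" using x(1) by simp
    then have i0: "0 < i" and C0: "0 < C" using i by (auto simp: zero_less_mult_iff)
    \<comment> \<open>The real value at \<open>y\<close> keeps the infimum over \<open>S\<close>
      from being infinite.\<close>
    obtain y where y: "ess_inf_on S \<eta> \<le> ereal (\<eta> y)"
      by (rule AE_lebesgue_on_open_witness[OF S(1,2) ess_inf_on_AE[where f=\<eta>]])
    have "AE x in lebesgue_on \<Omega>. x \<in> U t \<longrightarrow> ereal i \<le> ereal (\<eta> x)"
      using ess_inf_on_AE[where S="U t" and f=\<eta>] by (simp add: AE_lebesgue_on_open_subset[OF U(1,2) \<Omega>] i)
    then have "AE x in lebesgue_on \<Omega>. x \<in> S \<longrightarrow> ereal i \<le> ereal (\<eta> x)"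
      by eventually_elim (use S in auto)
    then have ile: "ereal i \<le> ess_inf_on S \<eta>"
      by (intro ess_inf_on_greatest meas S\<Omega>) (simp add: AE_lebesgue_on_open_subset[OF S(1) S\<Omega> \<Omega>])
    then obtain e where e: "ess_inf_on S \<eta> = ereal e" "i \<le> e"
      using y by (cases "ess_inf_on S \<eta>") auto
    have "AE x in lebesgue_on \<Omega>. x \<in> U t \<longrightarrow> ereal (\<eta> x) \<le> ess_sup_on (U t) \<eta>"
      using ess_sup_on_AE[where S="U t" and f=\<eta>] by (simp add: AE_lebesgue_on_open_subset[OF U(1,2) \<Omega>])
    moreover have Ce: "C * i \<le> max C 1 * e" using i0 C0 e by (intro mult_mono) auto
    ultimately have "AE x in lebesgue_on \<Omega>. x \<in> U t \<longrightarrow> \<eta> x \<le> max C 1 * e"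
    proof eventually_elim
      case (elim x)
      then have "ereal (\<eta> x) \<le> ereal (C * i)" by (intro order_trans[OF _ Ci]) auto
      then show ?case using Ce by simp
    qed
    moreover have "AE x in lebesgue_on \<Omega>. x \<in> S \<longrightarrow> e \<le> \<eta> x"
      using ess_inf_on_AE[where S=S and f=\<eta>] by (simp add: AE_lebesgue_on_open_subset[OF S(1) S\<Omega> \<Omega>] e)
    ultimately show "0 < real_of_ereal (ess_inf_on S \<eta>) \<and>
      (AE x in lebesgue_on \<Omega>. x \<in> S \<longrightarrow> real_of_ereal (ess_inf_on S \<eta>) \<le> \<eta> x) \<and>
      (AE x in lebesgue_on \<Omega>. x \<in> U t \<longrightarrow> \<eta> x \<le> max C 1 * real_of_ereal (ess_inf_on S \<eta>))"
      using i0 e by simp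
  qed simp
qed

section \<open>Decomposition along a tree\<close>

text \<open>Along an enumeration of the index set, each point is assigned to the first set that
  contains it.\<close>

lemma disjoint_refinement:
  assumes \<Gamma>: "countable \<Gamma>" and U: "\<And>t. t \<in> \<Gamma> \<Longrightarrow> U t \<in> sets M"
  shows "\<exists>X. (\<forall>t\<in>\<Gamma>. X t \<in> sets M \<and> X t \<subseteq> U t) \<and> disjoint_family_on X \<Gamma>
    \<and> (\<Union>t\<in>\<Gamma>. X t) = (\<Union>t\<in>\<Gamma>. U t)"
proof -
  define i where "i = to_nat_on \<Gamma>"
  have inj: "inj_on i \<Gamma>" using \<Gamma> by (simp add: i_def inj_on_to_nat_on)
  define X where "X t = U t - (\<Union>s\<in>{s \<in> \<Gamma>. i s < i t}. U s)" for t
  have "X t \<in> sets M" if "t \<in> \<Gamma>" for t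
    unfolding X_def using that U \<Gamma> by (intro sets.Diff sets.countable_UN') auto
  moreover have "X t \<subseteq> U t" for t by (auto simp: X_def)
  moreover have "disjoint_family_on X \<Gamma>"
    unfolding disjoint_family_on_def
  proof (intro ballI impI)
    fix s t assume "s \<in> \<Gamma>" "t \<in> \<Gamma>" "s \<noteq> t"
    then show "X s \<inter> X t = {}"
      using inj by (cases "i s" "i t" rule: linorder_cases) (auto simp: X_def inj_on_def)
  qed
  moreover have "(\<Union>t\<in>\<Gamma>. U t) \<subseteq> (\<Union>t\<in>\<Gamma>. X t)"
  proof
    fix x assume "x \<in> (\<Union>t\<in>\<Gamma>. U t)"
    then obtain t where "t \<in> \<Gamma> \<and> x \<in> U t" by auto
    then obtain r where "r \<in> \<Gamma> \<and> x \<in> U r" "\<And>s. s \<in> \<Gamma> \<and> x \<in> U s \<Longrightarrow> i r \<le> i s"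
      using ex_has_least_nat[of "\<lambda>t. t \<in> \<Gamma> \<and> x \<in> U t" t i] by blast
    then show "x \<in> (\<Union>t\<in>\<Gamma>. X t)" by (force simp: X_def)
  qed
  ultimately show ?thesis by blast
qed

text \<open>With at most one nonzero term the power passes through the sum without a constant.
  Applied to bumps on disjoint sets, this avoids any dependence on the number of children.\<close>

lemma sum_powr_single:
  fixes y :: "'i \<Rightarrow> real"
  assumes "finite J" and "0 < q" and one: "\<And>i j. i \<in> J \<Longrightarrow> j \<in> J \<Longrightarrow> y i \<noteq> 0 \<Longrightarrow> y j \<noteq> 0 \<Longrightarrow> i = j"
  shows "(\<Sum>j\<in>J. \<bar>y j\<bar>) powr q = (\<Sum>j\<in>J. \<bar>y j\<bar> powr q)"
proof (cases "\<exists>i\<in>J. y i \<noteq> 0")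
  case True
  then obtain i where i: "i \<in> J" "y i \<noteq> 0" by blast
  then have "y j = 0" if "j \<in> J - {i}" for j using one that by blast
  then show ?thesis using assms i by (simp add: sum.remove[of J i])
qed (use assms in simp)

text \<open>Only the measure-theoretic content of the covering is kept, with \<open>X\<close> a
  disjoint refinement of \<open>U\<close>. As \<open>measure\<close> is 0 on sets of infinite
  measure, \<open>B_pos\<close> also makes every \<open>B t\<close> a set of finite measure.\<close>

locale tree_partition =
  fixes M :: "'a measure" and \<Gamma> :: "'t set" and E :: "'t \<Rightarrow> 't \<Rightarrow> bool" and a :: 't
    and U B X :: "'t \<Rightarrow> 'a set"
  assumes tree: "rooted_tree \<Gamma> E a" and countable_vertices: "countable \<Gamma>"
    and B_sets: "\<And>t. t \<in> \<Gamma> - {a} \<Longrightarrow> B t \<in> sets M"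
    and B_sub: "\<And>t. t \<in> \<Gamma> - {a} \<Longrightarrow> B t \<subseteq> U t \<inter> U (tree_parent \<Gamma> E a t)"
    and B_disj: "disjoint_family_on B (\<Gamma> - {a})"
    and B_pos: "\<And>t. t \<in> \<Gamma> - {a} \<Longrightarrow> 0 < measure M (B t)"
    and X_sets: "\<And>t. t \<in> \<Gamma> \<Longrightarrow> X t \<in> sets M"
    and X_sub: "\<And>t. t \<in> \<Gamma> \<Longrightarrow> X t \<subseteq> U t"
    and X_disj: "disjoint_family_on X \<Gamma>"
    and X_cover: "AE x in M. x \<in> (\<Union>t\<in>\<Gamma>. X t)"
begin

definition subtree_integral :: "('a \<Rightarrow> real) \<Rightarrow> 't \<Rightarrow> real" where
  "subtree_integral g t = (LINT x|M. g x * indicator (\<Union>s\<in>subtree \<Gamma> E a t. X s) x)"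

text \<open>Normalised so that its integral is the whole mass of \<open>g\<close> at or below
  \<open>t\<close>. The bump at \<open>t\<close> represents the transfer along the edge from
  \<open>t\<close> to its parent.\<close>

definition bump :: "('a \<Rightarrow> real) \<Rightarrow> 't \<Rightarrow> 'a \<Rightarrow> real" where
  "bump g t x = subtree_integral g t / measure M (B t) * indicator (B t) x"

text \<open>The last sum has one term for \<open>t \<noteq> a\<close> and is empty at the root, which has no parent.\<close>

definition piece :: "('a \<Rightarrow> real) \<Rightarrow> 't \<Rightarrow> 'a \<Rightarrow> real" where
  "piece g t x = g x * indicator (X t) x + (\<Sum>c\<in>children \<Gamma> E a t. bump g c x)
     - (\<Sum>c\<in>{t} - {a}. bump g c x)"

lemma children_sub: "children \<Gamma> E a t \<subseteq> \<Gamma> - {a}"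
  by (auto simp: children_def)

lemma finite_children: "t \<in> \<Gamma> \<Longrightarrow> finite (children \<Gamma> E a t)"
  using tree by (simp add: rooted_tree_def children_def)

lemma notin_children: "t \<in> \<Gamma> \<Longrightarrow> t \<notin> children \<Gamma> E a t"
  using notin_subtree_child[OF tree, of t t] subtree_eq[OF tree, of t] by auto

lemma children_disj: "disjoint_family_on (children \<Gamma> E a) \<Gamma>"
  by (auto simp: disjoint_family_on_def children_def)

lemma subtree_sub: "subtree \<Gamma> E a t \<subseteq> \<Gamma>"
  by (auto simp: subtree_def)

lemma subtree_UN_sets: "(\<Union>s\<in>subtree \<Gamma> E a t. X s) \<in> sets M"
  using subtree_sub countable_vertices X_sets
  by (intro sets.countable_UN') (auto intro: countable_subset)

lemma parent_in: "s \<in> \<Gamma> - {a} \<Longrightarrow> tree_parent \<Gamma> E a s \<in> \<Gamma>"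
  using root_path_step(1)[OF tree] by auto

lemma integrable_mult_sets: "integrable M g \<Longrightarrow> A \<in> sets M \<Longrightarrow> integrable M (\<lambda>x. g x * indicator A x :: real)"
  by (rule integrable_mult_indicator[of A M g, simplified mult.commute[of "indicator _ _"] real_scaleR_def])

text \<open>The region of a subtree is the disjoint union of \<open>X t\<close> and the regions of
  the finitely many child subtrees, so its indicator is a finite sum.\<close>

lemma subtree_integral_step:
  assumes t: "t \<in> \<Gamma>" and g: "integrable M g"
  shows "subtree_integral g t
    = (LINT x|M. g x * indicator (X t) x) + (\<Sum>c\<in>children \<Gamma> E a t. subtree_integral g c)"
proof -
  let ?W = "\<lambda>t. \<Union>s\<in>subtree \<Gamma> E a t. X s"
  have disj: "X s \<inter> X r = {}" if "s \<in> \<Gamma>" "r \<in> \<Gamma>" "s \<noteq> r" for s r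
    using X_disj that by (auto simp: disjoint_family_on_def)
  have W: "?W t = X t \<union> (\<Union>c\<in>children \<Gamma> E a t. ?W c)"
    by (subst subtree_eq[OF tree t]) auto
  have 1: "X t \<inter> (\<Union>c\<in>children \<Gamma> E a t. ?W c) = {}"
    using notin_subtree_child[OF tree] subtree_sub disj[OF t] by blast
  have 2: "disjoint_family_on ?W (children \<Gamma> E a t)"
    unfolding disjoint_family_on_def
  proof (intro ballI impI)
    fix c d assume "c \<in> children \<Gamma> E a t" "d \<in> children \<Gamma> E a t" "c \<noteq> d"
    then have "subtree \<Gamma> E a c \<inter> subtree \<Gamma> E a d = {}"
      by (rule subtree_child_disjoint[OF tree])
    then show "?W c \<inter> ?W d = {}"
      using disj subtree_sub by (fastforce simp: disjoint_iff)
  qed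
  have "indicator (?W t) x = indicator (X t) x + (\<Sum>c\<in>children \<Gamma> E a t. indicator (?W c) x :: real)" for x
    unfolding W indicator_add[OF 1, symmetric]
    by (subst indicator_UN_disjoint[OF finite_children[OF t] 2]) simp
  then have "subtree_integral g t
    = (LINT x|M. g x * indicator (X t) x + (\<Sum>c\<in>children \<Gamma> E a t. g x * indicator (?W c) x))"
    by (simp add: subtree_integral_def algebra_simps sum_distrib_left)
  also have "\<dots> = (LINT x|M. g x * indicator (X t) x) + (\<Sum>c\<in>children \<Gamma> E a t. LINT x|M. g x * indicator (?W c) x)"
    using integrable_mult_sets[OF g] X_sets[OF t] subtree_UN_sets
    by (subst Bochner_Integration.integral_add)
       (auto intro!: Bochner_Integration.integral_sum Bochner_Integration.integrable_sum)
  finally show ?thesis by (simp add: subtree_integral_def)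
qed

lemma subtree_integral_root:
  assumes "integrable M g"
  shows "subtree_integral g a = (LINT x|M. g x)"
  unfolding subtree_integral_def subtree_root[OF tree]
proof (rule integral_cong_AE)
  have W: "(\<Union>t\<in>\<Gamma>. X t) \<in> sets M" using subtree_UN_sets[of a] by (simp add: subtree_root[OF tree])
  show "(\<lambda>x. g x * indicator (\<Union>t\<in>\<Gamma>. X t) x) \<in> borel_measurable M"
    using integrable_mult_sets[OF assms W] by simp
  show "AE x in M. g x * indicator (\<Union>t\<in>\<Gamma>. X t) x = g x"
    using X_cover by eventually_elim simp
qed (use assms in simp)

text \<open>The bound has the shape of the inner sum in the Hardy inequality. In
  \<open>ennreal\<close> no summability has to be checked.\<close>

lemma ennreal_subtree_integral_le:
  assumes g: "integrable M g"
  shows "ennreal \<bar>subtree_integral g t\<bar>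
    \<le> (\<Sum>\<^sub>\<infinity>s\<in>subtree \<Gamma> E a t. ennreal (LINT x|M. indicator (X s) x * \<bar>g x\<bar>))"
proof -
  let ?W = "\<Union>s\<in>subtree \<Gamma> E a t. X s"
  have [measurable]: "g \<in> borel_measurable M" using g by simp
  have "ennreal \<bar>subtree_integral g t\<bar> \<le> (\<integral>\<^sup>+x. norm (g x * indicator ?W x) \<partial>M)"
    unfolding subtree_integral_def real_norm_def[symmetric]
    by (rule integral_norm_bound_ennreal[OF integrable_mult_sets[OF g subtree_UN_sets]])
  also have "\<dots> = (\<integral>\<^sup>+x. ennreal \<bar>g x\<bar> * indicator ?W x \<partial>M)"
    by (intro nn_integral_cong) (auto simp: indicator_def)
  also have "\<dots> = (\<Sum>\<^sub>\<infinity>s\<in>subtree \<Gamma> E a t. \<integral>\<^sup>+x. ennreal \<bar>g x\<bar> * indicator (X s) x \<partial>M)"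
    using subtree_sub countable_vertices X_sets X_disj
    by (intro nn_integral_UN_eq_infsum)
       (auto intro: countable_subset disjoint_family_on_mono)
  also have "\<dots> = (\<Sum>\<^sub>\<infinity>s\<in>subtree \<Gamma> E a t. ennreal (LINT x|M. indicator (X s) x * \<bar>g x\<bar>))"
  proof (rule infsum_cong)
    fix s assume "s \<in> subtree \<Gamma> E a t"
    then have s: "s \<in> \<Gamma>" using subtree_sub by blast
    have "(\<integral>\<^sup>+x. ennreal \<bar>g x\<bar> * indicator (X s) x \<partial>M) = (\<integral>\<^sup>+x. ennreal (indicator (X s) x * \<bar>g x\<bar>) \<partial>M)"
      by (intro nn_integral_cong) (auto simp: indicator_def)
    also have "\<dots> = ennreal (LINT x|M. indicator (X s) x * \<bar>g x\<bar>)"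
      using integrable_mult_sets[OF integrable_abs[OF g] X_sets[OF s]]
      by (intro nn_integral_eq_integral) (auto simp: mult.commute)
    finally show "(\<integral>\<^sup>+x. ennreal \<bar>g x\<bar> * indicator (X s) x \<partial>M) = ennreal (LINT x|M. indicator (X s) x * \<bar>g x\<bar>)" .
  qed
  finally show ?thesis .
qed

section \<open>Integrals, supports and sum of the pieces\<close>

lemma integrable_bump:
  assumes "t \<in> \<Gamma> - {a}"
  shows "integrable M (bump g t)"
proof -
  have "emeasure M (B t) < \<infinity>"
    using B_pos[OF assms] by (auto simp: measure_def less_top[symmetric])
  then show ?thesis unfolding bump_def
    using B_sets[OF assms] by (intro integrable_mult_right integrable_real_indicator)
qed

lemma integral_bump:
  assumes "t \<in> \<Gamma> - {a}"
  shows "(LINT x|M. bump g t x) = subtree_integral g t"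
  using B_pos[OF assms] B_sets[OF assms] by (simp add: bump_def)

lemma integrable_piece:
  assumes "t \<in> \<Gamma>" and "integrable M g"
  shows "integrable M (piece g t)"
  unfolding piece_def using assms children_sub[of t] X_sets
  by (intro Bochner_Integration.integrable_diff Bochner_Integration.integrable_add
      Bochner_Integration.integrable_sum integrable_bump integrable_mult_sets) auto

text \<open>The mass of \<open>g\<close> on \<open>X t\<close> plus what the children send up is
  \<open>subtree_integral g t\<close>, which is exactly what is sent on to the parent. The root
  sends nothing on, but there the total is the integral of \<open>g\<close>.\<close>

lemma integral_piece:
  assumes t: "t \<in> \<Gamma>" and g: "integrable M g" and "(LINT x|M. g x) = 0"
  shows "(LINT x|M. piece g t x) = 0"
proof -
  have b: "integrable M (bump g c)" if "c \<in> children \<Gamma> E a t \<or> c \<in> {t} - {a}" for c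
    using that children_sub t by (intro integrable_bump) blast
  have i: "(LINT x|M. bump g c x) = subtree_integral g c" if "c \<in> children \<Gamma> E a t \<or> c \<in> {t} - {a}" for c
    using that children_sub t by (intro integral_bump) blast
  have "(LINT x|M. piece g t x) = (LINT x|M. g x * indicator (X t) x)
      + (\<Sum>c\<in>children \<Gamma> E a t. LINT x|M. bump g c x) - (\<Sum>c\<in>{t} - {a}. LINT x|M. bump g c x)"
  proof -
    have I: "integrable M (\<lambda>x. g x * indicator (X t) x)"
      "integrable M (\<lambda>x. \<Sum>c\<in>children \<Gamma> E a t. bump g c x)" "integrable M (\<lambda>x. \<Sum>c\<in>{t} - {a}. bump g c x)"
      using b integrable_mult_sets[OF g X_sets[OF t]] by (blast intro: Bochner_Integration.integrable_sum)+
    have "(LINT x|M. (\<Sum>c\<in>J. bump g c x)) = (\<Sum>c\<in>J. LINT x|M. bump g c x)"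
      if "J = children \<Gamma> E a t \<or> J = {t} - {a}" for J
      using b that by (intro Bochner_Integration.integral_sum) blast
    then show ?thesis using I by (simp add: piece_def)
  qed
  also have "\<dots> = subtree_integral g t - (\<Sum>c\<in>{t} - {a}. subtree_integral g c)"
  proof -
    have "(\<Sum>c\<in>J. LINT x|M. bump g c x) = (\<Sum>c\<in>J. subtree_integral g c)"
      if "J = children \<Gamma> E a t \<or> J = {t} - {a}" for J
      using i that by (intro sum.cong refl) blast
    then show ?thesis by (simp only: subtree_integral_step[OF t g] simp_thms)
  qed
  also have "\<dots> = 0"
    using subtree_integral_root[OF g] assms(3) by (cases "t = a") auto
  finally show ?thesis .
qed

lemma bump_eq_0: "x \<notin> B t \<Longrightarrow> bump g t x = 0"
  by (simp add: bump_def)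

lemma bump_unique:
  assumes "c \<in> \<Gamma> - {a}" "d \<in> \<Gamma> - {a}" "bump g c x \<noteq> 0" "bump g d x \<noteq> 0"
  shows "c = d"
  using assms bump_eq_0 B_disj unfolding disjoint_family_on_def by blast

text \<open>The set \<open>B c\<close> of a child \<open>c\<close> of \<open>t\<close> lies in the
  overlap of \<open>U c\<close> with \<open>U t\<close>, and \<open>B t\<close> lies in
  \<open>U t\<close>; thus every term of the piece lives on \<open>U t\<close>.\<close>

lemma piece_outside:
  assumes t: "t \<in> \<Gamma>" and x: "x \<notin> U t"
  shows "piece g t x = 0"
proof -
  have "bump g c x = 0" if "c \<in> children \<Gamma> E a t" for c
    using that x B_sub[of c] children_sub by (intro bump_eq_0) (auto simp: children_def)
  moreover have "bump g c x = 0" if "c \<in> {t} - {a}" for c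
    using that x B_sub[of c] t by (intro bump_eq_0) auto
  moreover have "x \<notin> X t" using X_sub[OF t] x by blast
  ultimately have "(\<Sum>c\<in>children \<Gamma> E a t. bump g c x) = 0" "(\<Sum>c\<in>{t} - {a}. bump g c x) = 0"
    "x \<notin> X t" by (blast intro: sum.neutral)+
  then show ?thesis by (simp only: piece_def) simp
qed

text \<open>For almost every \<open>x\<close> at most three pieces are nonzero: that of the
  \<open>X r\<close> containing \<open>x\<close>, and those of the one \<open>s\<close> with
  \<open>x\<close> in \<open>B s\<close> and of its parent.\<close>

lemma has_sum_piece: "AE x in M. ((\<lambda>t. piece g t x) has_sum g x) \<Gamma>"
  using X_cover
proof eventually_elim
  case (elim x)
  then obtain r where r: "r \<in> \<Gamma>" "x \<in> X r" by blast
  have "((\<lambda>t. g x * indicator (X t) x) has_sum g x) \<Gamma>"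
    by (rule has_sum_finite_neutralI[of "{r}"])
       (use r X_disj in \<open>auto simp: disjoint_family_on_def indicator_def\<close>)
  \<comment> \<open>The bump of \<open>s\<close> enters with a plus sign in the piece of its parent
    and with a minus sign in the piece of \<open>s\<close>. Both sums therefore have the same value
    \<open>K\<close> and cancel.\<close>
  moreover have "\<exists>K. ((\<lambda>t. \<Sum>c\<in>children \<Gamma> E a t. bump g c x) has_sum K) \<Gamma>
      \<and> ((\<lambda>t. \<Sum>c\<in>{t} - {a}. bump g c x) has_sum K) \<Gamma>"
  proof (cases "\<exists>s\<in>\<Gamma> - {a}. bump g s x \<noteq> 0")
    case True
    then obtain s where s: "s \<in> \<Gamma> - {a}" "bump g s x \<noteq> 0" by blast
    have z: "bump g c x = 0" if "c \<in> \<Gamma> - {a}" "c \<noteq> s" for c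
      using bump_unique[OF that(1) s(1) _ s(2)] that(2) by blast
    let ?p = "tree_parent \<Gamma> E a s"
    have "((\<lambda>t. \<Sum>c\<in>children \<Gamma> E a t. bump g c x) has_sum bump g s x) \<Gamma>"
    proof (rule has_sum_finite_neutralI[of "{?p}"])
      show "bump g s x = (\<Sum>t\<in>{?p}. \<Sum>c\<in>children \<Gamma> E a t. bump g c x)"
      proof -
        have "(\<Sum>c\<in>children \<Gamma> E a ?p. bump g c x) = (\<Sum>c\<in>{s}. bump g c x)"
          using s z finite_children[OF parent_in[OF s(1)]]
          by (intro sum.mono_neutral_right) (auto simp: children_def)
        then show ?thesis by simp
      qed
      show "(\<Sum>c\<in>children \<Gamma> E a t. bump g c x) = 0" if "t \<in> \<Gamma> - {?p}" for t
        using that z by (intro sum.neutral) (auto simp: children_def)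
    qed (use parent_in s in auto)
    moreover have "((\<lambda>t. \<Sum>c\<in>{t} - {a}. bump g c x) has_sum bump g s x) \<Gamma>"
      by (rule has_sum_finite_neutralI[of "{s}"]) (use s z in \<open>auto intro!: sum.neutral\<close>)
    ultimately show ?thesis by blast
  next
    case False
    then have "(\<Sum>c\<in>children \<Gamma> E a t. bump g c x) = 0" "t \<in> \<Gamma> \<Longrightarrow> (\<Sum>c\<in>{t} - {a}. bump g c x) = 0" for t
      using children_sub by (auto intro!: sum.neutral)
    then show ?thesis by (intro exI[of _ 0] conjI has_sum_0) auto
  qed
  then obtain K where "((\<lambda>t. \<Sum>c\<in>children \<Gamma> E a t. bump g c x) has_sum K) \<Gamma>"
    "((\<lambda>t. \<Sum>c\<in>{t} - {a}. bump g c x) has_sum K) \<Gamma>" by blast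
  ultimately have "((\<lambda>t. piece g t x) has_sum (g x + K + - K)) \<Gamma>"
    unfolding piece_def diff_conv_add_uminus by (intro has_sum_add) (simp_all only: has_sum_uminus minus_minus)
  then show ?case by simp
qed

section \<open>Weighted norms of the pieces\<close>

lemma piece_powr_le:
  assumes t: "t \<in> \<Gamma>" and q: "0 < q"
  shows "\<bar>piece g t x\<bar> powr q \<le> 2 powr q * (\<bar>g x\<bar> powr q * indicator (X t) x
    + (\<Sum>c\<in>children \<Gamma> E a t. \<bar>bump g c x\<bar> powr q) + (\<Sum>c\<in>{t} - {a}. \<bar>bump g c x\<bar> powr q))"
proof -
  let ?J = "children \<Gamma> E a t \<union> ({t} - {a})"
  have J: "?J \<subseteq> \<Gamma> - {a}" using t children_sub by blast
  \<comment> \<open>No vertex is its own child, so incoming and outgoing bumps can be treated as one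
    family.\<close>
  have split: "sum f ?J = sum f (children \<Gamma> E a t) + sum f ({t} - {a})" for f :: "'t \<Rightarrow> real"
    using finite_children[OF t] notin_children[OF t] by (intro sum.union_disjoint) auto
  have "\<bar>piece g t x\<bar> \<le> \<bar>g x * indicator (X t) x\<bar> + (\<Sum>c\<in>?J. \<bar>bump g c x\<bar>)"
    unfolding piece_def split
    using sum_abs[of "\<lambda>c. bump g c x" "children \<Gamma> E a t"] sum_abs[of "\<lambda>c. bump g c x" "{t} - {a}"]
    by linarith
  then have "\<bar>piece g t x\<bar> powr q \<le> (\<bar>g x * indicator (X t) x\<bar> + (\<Sum>c\<in>?J. \<bar>bump g c x\<bar>)) powr q"
    using q by (intro powr_mono2) auto
  also have "\<dots> \<le> 2 powr q * (\<bar>g x * indicator (X t) x\<bar> powr q + (\<Sum>c\<in>?J. \<bar>bump g c x\<bar>) powr q)"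
    using q by (intro add_powr_le) (auto intro!: sum_nonneg)
  \<comment> \<open>At each point at most one bump is nonzero, so the factor \<open>2 powr q\<close>
    is the only loss.\<close>
  also have "(\<Sum>c\<in>?J. \<bar>bump g c x\<bar>) powr q = (\<Sum>c\<in>?J. \<bar>bump g c x\<bar> powr q)"
    using finite_children[OF t] q J bump_unique[of _ _ g x] by (intro sum_powr_single) blast+
  also have "\<bar>g x * indicator (X t) x\<bar> powr q = \<bar>g x\<bar> powr q * indicator (X t) x"
    by (auto simp: indicator_def)
  finally show ?thesis by (simp only: split add.assoc)
qed

text \<open>On \<open>B t\<close> the bump is the constant mass divided by \<open>|B t|\<close>. Its
  power contributes the exponent \<open>-q\<close> and the integration over \<open>B t\<close> adds
  1.\<close>

lemma nn_integral_bump_le: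
  assumes t: "t \<in> \<Gamma> - {a}" and "0 < q" and w: "0 \<le> w" "AE x in M. x \<in> B t \<longrightarrow> v x \<le> ennreal w"
  shows "(\<integral>\<^sup>+x. ennreal (\<bar>bump g t x\<bar> powr q) * v x \<partial>M)
    \<le> ennreal (measure M (B t) powr (1 - q) * w * \<bar>subtree_integral g t\<bar> powr q)"
proof -
  let ?k = "(\<bar>subtree_integral g t\<bar> / measure M (B t)) powr q"
  have "(\<integral>\<^sup>+x. ennreal (\<bar>bump g t x\<bar> powr q) * v x \<partial>M)
      \<le> (\<integral>\<^sup>+x. ennreal (?k * w) * indicator (B t) x \<partial>M)"
  proof (rule nn_integral_mono_AE)
    show "AE x in M. ennreal (\<bar>bump g t x\<bar> powr q) * v x \<le> ennreal (?k * w) * indicator (B t) x"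
      using w(2) by eventually_elim
        (use w(1) in \<open>auto simp: bump_def indicator_def ennreal_mult abs_mult intro!: mult_left_mono\<close>)
  qed
  also have "\<dots> = ennreal (?k * w) * emeasure M (B t)"
    using B_sets[OF t] by (rule nn_integral_cmult_indicator)
  also have "emeasure M (B t) = ennreal (measure M (B t))"
    using B_pos[OF t] by (intro emeasure_eq_ennreal_measure) (auto simp: measure_def)
  also have "ennreal (?k * w) * \<dots> = ennreal (measure M (B t) powr (1 - q) * w * \<bar>subtree_integral g t\<bar> powr q)"
    using w(1) B_pos[OF t]
    by (simp add: powr_divide powr_diff field_simps flip: ennreal_mult)
  finally show ?thesis .
qed

lemma nn_integral_piece_le:
  assumes t: "t \<in> \<Gamma>" and q: "0 < q" and g: "integrable M g" and [measurable]: "v \<in> borel_measurable M"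
  shows "(\<integral>\<^sup>+x. ennreal (\<bar>piece g t x\<bar> powr q) * v x \<partial>M)
    \<le> ennreal (2 powr q) * ((\<integral>\<^sup>+x. ennreal (\<bar>g x\<bar> powr q) * v x * indicator (X t) x \<partial>M)
      + (\<Sum>c\<in>children \<Gamma> E a t. \<integral>\<^sup>+x. ennreal (\<bar>bump g c x\<bar> powr q) * v x \<partial>M)
      + (\<Sum>c\<in>{t} - {a}. \<integral>\<^sup>+x. ennreal (\<bar>bump g c x\<bar> powr q) * v x \<partial>M))"
proof -
  have [measurable]: "g \<in> borel_measurable M" "X t \<in> sets M" using g X_sets[OF t] by auto
  have bm: "(\<lambda>x. ennreal (\<bar>bump g c x\<bar> powr q) * v x) \<in> borel_measurable M" if "c \<in> \<Gamma> - {a}" for c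
  proof -
    have [measurable]: "bump g c \<in> borel_measurable M" using integrable_bump[OF that] by simp
    show ?thesis by measurable
  qed
  have S: "(\<lambda>x. \<Sum>c\<in>J. ennreal (\<bar>bump g c x\<bar> powr q) * v x) \<in> borel_measurable M"
    "(\<integral>\<^sup>+x. (\<Sum>c\<in>J. ennreal (\<bar>bump g c x\<bar> powr q) * v x) \<partial>M)
      = (\<Sum>c\<in>J. \<integral>\<^sup>+x. ennreal (\<bar>bump g c x\<bar> powr q) * v x \<partial>M)" if "J \<subseteq> \<Gamma> - {a}" for J
    using bm that by (auto intro!: borel_measurable_sum nn_integral_sum simp del: insert_Diff_if)
  have J: "children \<Gamma> E a t \<subseteq> \<Gamma> - {a}" "{t} - {a} \<subseteq> \<Gamma> - {a}" using children_sub t by auto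
  note [measurable] = S(1)[OF J(1)] S(1)[OF J(2)]
  have "ennreal (\<bar>piece g t x\<bar> powr q) * v x \<le> ennreal (2 powr q) *
      (ennreal (\<bar>g x\<bar> powr q) * v x * indicator (X t) x + (\<Sum>c\<in>children \<Gamma> E a t. ennreal (\<bar>bump g c x\<bar> powr q) * v x)
        + (\<Sum>c\<in>{t} - {a}. ennreal (\<bar>bump g c x\<bar> powr q) * v x))" for x
  proof -
    have "ennreal (\<bar>piece g t x\<bar> powr q) * v x \<le> ennreal (2 powr q * (\<bar>g x\<bar> powr q * indicator (X t) x
        + (\<Sum>c\<in>children \<Gamma> E a t. \<bar>bump g c x\<bar> powr q) + (\<Sum>c\<in>{t} - {a}. \<bar>bump g c x\<bar> powr q))) * v x"
      by (intro mult_right_mono ennreal_leI piece_powr_le t q) auto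
    also have "\<dots> = ennreal (2 powr q) * (ennreal (\<bar>g x\<bar> powr q) * indicator (X t) x
        + (\<Sum>c\<in>children \<Gamma> E a t. ennreal (\<bar>bump g c x\<bar> powr q)) + (\<Sum>c\<in>{t} - {a}. ennreal (\<bar>bump g c x\<bar> powr q))) * v x"
      by (simp add: ennreal_mult ennreal_plus sum_nonneg sum_ennreal ennreal_indicator
          del: insert_Diff_if)
    finally show ?thesis
      by (simp add: distrib_left distrib_right sum_distrib_left sum_distrib_right mult_ac del: sum_ennreal)
  qed
  then have "(\<integral>\<^sup>+x. ennreal (\<bar>piece g t x\<bar> powr q) * v x \<partial>M) \<le> (\<integral>\<^sup>+x. ennreal (2 powr q) *
      (ennreal (\<bar>g x\<bar> powr q) * v x * indicator (X t) x + (\<Sum>c\<in>children \<Gamma> E a t. ennreal (\<bar>bump g c x\<bar> powr q) * v x)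
        + (\<Sum>c\<in>{t} - {a}. ennreal (\<bar>bump g c x\<bar> powr q) * v x)) \<partial>M)"
    by (rule nn_integral_mono)
  also have "\<dots> = ennreal (2 powr q) * ((\<integral>\<^sup>+x. ennreal (\<bar>g x\<bar> powr q) * v x * indicator (X t) x \<partial>M)
      + (\<Sum>c\<in>children \<Gamma> E a t. \<integral>\<^sup>+x. ennreal (\<bar>bump g c x\<bar> powr q) * v x \<partial>M)
      + (\<Sum>c\<in>{t} - {a}. \<integral>\<^sup>+x. ennreal (\<bar>bump g c x\<bar> powr q) * v x \<partial>M))"
    by (simp add: nn_integral_cmult nn_integral_add S(2)[OF J(1)] S(2)[OF J(2)] del: insert_Diff_if)
  finally show ?thesis .
qed

text \<open>The parts of \<open>g\<close> add up by disjointness of the sets \<open>X t\<close>.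
  Each bump is charged twice, to its own vertex and to the parent, whence the factor 2.\<close>

lemma infsum_nn_integral_pieces_le:
  assumes q: "0 < q" and g: "integrable M g" and [measurable]: "v \<in> borel_measurable M"
    and w: "\<And>t. t \<in> \<Gamma> - {a} \<Longrightarrow> 0 \<le> w t"
      "\<And>t. t \<in> \<Gamma> - {a} \<Longrightarrow> AE x in M. x \<in> B t \<longrightarrow> v x \<le> ennreal (w t)"
  shows "(\<Sum>\<^sub>\<infinity>t\<in>\<Gamma>. \<integral>\<^sup>+x. ennreal (\<bar>piece g t x\<bar> powr q) * v x \<partial>M)
    \<le> ennreal (2 powr q) * ((\<integral>\<^sup>+x. ennreal (\<bar>g x\<bar> powr q) * v x \<partial>M)
      + 2 * (\<Sum>\<^sub>\<infinity>t\<in>\<Gamma> - {a}. ennreal (measure M (B t) powr (1 - q) * w t * \<bar>subtree_integral g t\<bar> powr q)))"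
proof -
  define P where "P t = (\<integral>\<^sup>+x. ennreal (\<bar>g x\<bar> powr q) * v x * indicator (X t) x \<partial>M)" for t
  define Q where "Q t = (\<integral>\<^sup>+x. ennreal (\<bar>bump g t x\<bar> powr q) * v x \<partial>M)" for t
  define R where "R = (\<Sum>\<^sub>\<infinity>t\<in>\<Gamma> - {a}. ennreal (measure M (B t) powr (1 - q) * w t * \<bar>subtree_integral g t\<bar> powr q))"
  have [measurable]: "g \<in> borel_measurable M" using g by simp
  have QR: "infsum Q (\<Gamma> - {a}) \<le> R"
    unfolding Q_def R_def
    by (intro infsum_mono nn_integral_bump_le q w) (auto simp: nonneg_summable_on_complete)
  have "infsum P \<Gamma> = (\<integral>\<^sup>+x. ennreal (\<bar>g x\<bar> powr q) * v x * indicator (\<Union>t\<in>\<Gamma>. X t) x \<partial>M)"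
    unfolding P_def using X_sets by (intro nn_integral_UN_eq_infsum[symmetric] countable_vertices X_disj) auto
  also have "\<dots> \<le> (\<integral>\<^sup>+x. ennreal (\<bar>g x\<bar> powr q) * v x \<partial>M)"
    by (intro nn_integral_mono) (auto simp: indicator_def)
  finally have PI: "infsum P \<Gamma> \<le> (\<integral>\<^sup>+x. ennreal (\<bar>g x\<bar> powr q) * v x \<partial>M)" .
  \<comment> \<open>Sets of children of different vertices are disjoint because a vertex has only
    one parent.\<close>
  have ch: "(\<Sum>\<^sub>\<infinity>t\<in>\<Gamma>. \<Sum>c\<in>children \<Gamma> E a t. Q c) \<le> R"
    by (rule order_trans[OF infsum_sum_disjoint_le QR])
       (use finite_children children_sub children_disj in auto)
  have self: "(\<Sum>\<^sub>\<infinity>t\<in>\<Gamma>. \<Sum>c\<in>{t} - {a}. Q c) \<le> R"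
    by (rule order_trans[OF infsum_sum_disjoint_le QR]) (auto simp: disjoint_family_on_def)
  have "(\<Sum>\<^sub>\<infinity>t\<in>\<Gamma>. \<integral>\<^sup>+x. ennreal (\<bar>piece g t x\<bar> powr q) * v x \<partial>M)
      \<le> (\<Sum>\<^sub>\<infinity>t\<in>\<Gamma>. ennreal (2 powr q) * (P t + (\<Sum>c\<in>children \<Gamma> E a t. Q c) + (\<Sum>c\<in>{t} - {a}. Q c)))"
    unfolding P_def Q_def
    by (intro infsum_mono nn_integral_piece_le q g) (auto simp: nonneg_summable_on_complete)
  also have "\<dots> = ennreal (2 powr q) * (infsum P \<Gamma> + (\<Sum>\<^sub>\<infinity>t\<in>\<Gamma>. \<Sum>c\<in>children \<Gamma> E a t. Q c) + (\<Sum>\<^sub>\<infinity>t\<in>\<Gamma>. \<Sum>c\<in>{t} - {a}. Q c))"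
    by (simp add: nn_integral_cmult nn_integral_add del: insert_Diff_if
        flip: nn_integral_count_space_eq_infsum[OF countable_vertices])
  also have "\<dots> \<le> ennreal (2 powr q) * ((\<integral>\<^sup>+x. ennreal (\<bar>g x\<bar> powr q) * v x \<partial>M) + R + R)"
    by (intro mult_left_mono add_mono PI ch self) auto
  finally show ?thesis by (simp add: R_def mult_2 add.assoc)
qed

end

section \<open>Weighted estimates\<close>

text \<open>Meant for \<open>A = X t\<close>, \<open>V = |U t|\<close>,
  \<open>\<beta> = |B t|\<close> and \<open>e = \<omega>\<^sub>t\<close>. Hoelder's inequality
  produces \<open>V powr (q / p)\<close>, which the ratio bound compares with
  \<open>\<beta>\<close>; the upper bound on \<open>\<omega>\<close> inserts the weight at the cost
  of \<open>K powr q\<close>.\<close>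

lemma weighted_average_powr_le:
  fixes g \<omega> :: "'a \<Rightarrow> real"
  assumes pq: "1 < p" "1 < q" "1 / p + 1 / q = 1"
    and A [measurable]: "A \<in> sets M" and V: "emeasure M A \<le> ennreal V" "0 < V" "0 < \<beta>" "V / \<beta> \<le> C"
    and K: "0 < K" "0 < e" and \<omega>: "AE x in M. x \<in> A \<longrightarrow> 0 < \<omega> x \<and> \<omega> x \<le> K * e"
    and g: "integrable M g" "integrable M (\<lambda>x. \<bar>g x\<bar> powr q * \<omega> x powr (-q))"
  shows "\<beta> powr (- q / p) * e powr (-q) * (LINT x|M. indicator A x * \<bar>g x\<bar>) powr q
    \<le> C powr (q / p) * K powr q * (LINT x|M. indicator A x * (\<bar>g x\<bar> powr q * \<omega> x powr (-q)))"
    (is "_ \<le> _ * ?Z")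
proof -
  have [measurable]: "g \<in> borel_measurable M" using g by simp
  let ?Y = "LINT x|M. indicator A x * \<bar>g x\<bar> powr q"
  have intZ: "integrable M (\<lambda>x. indicator A x * (\<bar>g x\<bar> powr q * \<omega> x powr (-q)))"
    using integrable_mult_indicator[OF A g(2)] by simp
  have pointwise: "AE x in M. indicator A x * \<bar>g x\<bar> powr q
      \<le> (K * e) powr q * (indicator A x * (\<bar>g x\<bar> powr q * \<omega> x powr (-q)))"
    using \<omega>
  proof eventually_elim
    case (elim x)
    show ?case
    proof (cases "x \<in> A")
      case True
      then have w: "0 < \<omega> x" "\<omega> x \<le> K * e" using elim by auto
      then have "\<omega> x powr q * \<omega> x powr (-q) \<le> (K * e) powr q * \<omega> x powr (-q)"
        using pq by (intro mult_right_mono powr_mono2) auto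
      then have "1 \<le> (K * e) powr q * \<omega> x powr (-q)" using w by (simp flip: powr_add)
      then have "\<bar>g x\<bar> powr q * 1 \<le> \<bar>g x\<bar> powr q * ((K * e) powr q * \<omega> x powr (-q))"
        by (intro mult_left_mono) auto
      then show ?thesis using True by (simp add: mult_ac)
    qed simp
  qed
  have intY: "integrable M (\<lambda>x. indicator A x * \<bar>g x\<bar> powr q)"
    by (rule Bochner_Integration.integrable_bound[OF integrable_mult_right[OF intZ, of "(K * e) powr q"]])
       (use pointwise in \<open>auto elim!: eventually_mono\<close>)
  have "?Y \<le> (LINT x|M. (K * e) powr q * (indicator A x * (\<bar>g x\<bar> powr q * \<omega> x powr (-q))))"
    by (intro integral_mono_AE intY integrable_mult_right intZ pointwise)
  then have Y: "?Y \<le> (K * e) powr q * ?Z" by simp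
  have Z0: "0 \<le> ?Z" by (intro integral_nonneg_AE) auto
  have "\<beta> powr (- q / p) * e powr (-q) * (LINT x|M. indicator A x * \<bar>g x\<bar>) powr q
      \<le> \<beta> powr (- q / p) * e powr (-q) * (V powr (q / p) * ((K * e) powr q * ?Z))"
    by (intro mult_left_mono order_trans[OF set_integral_powr_le[OF pq A V(1,2) g(1) intY]] Y) auto
  also have "\<dots> = (V / \<beta>) powr (q / p) * K powr q * ?Z"
    using V K by (simp add: powr_divide powr_mult powr_minus field_simps)
  also have "\<dots> \<le> C powr (q / p) * K powr q * ?Z"
    using V pq Z0 by (intro mult_right_mono powr_mono2) auto
  finally show ?thesis .
qed

text \<open>Young's inequality for the factors \<open>|g| / \<omega>\<close> and
  \<open>\<omega>\<close> dominates \<open>|g|\<close> by two integrable functions.\<close>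

lemma integrable_of_weighted_Lq:
  assumes pq: "1 < p" "1 < q" "1 / p + 1 / q = 1"
    and \<omega>: "AE x in lebesgue_on \<Omega>. 0 < \<omega> x" "integrable (lebesgue_on \<Omega>) (\<lambda>x. \<omega> x powr p)"
    and g: "g \<in> weighted_Lq \<Omega> q (\<lambda>x. \<omega> x powr (-q))"
  shows "integrable (lebesgue_on \<Omega>) g"
proof (rule Bochner_Integration.integrable_bound)
  show "integrable (lebesgue_on \<Omega>) (\<lambda>x. \<bar>g x\<bar> powr q * \<omega> x powr (-q) / q + \<omega> x powr p / p)"
    using g \<omega>(2) by (auto simp: weighted_Lq_def)
  show "g \<in> borel_measurable (lebesgue_on \<Omega>)" using g by (simp add: weighted_Lq_def)
  show "AE x in lebesgue_on \<Omega>. norm (g x) \<le> norm (\<bar>g x\<bar> powr q * \<omega> x powr (-q) / q + \<omega> x powr p / p)"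
    using \<omega>(1)
  proof eventually_elim
    case (elim x)
    have "\<bar>g x\<bar> = \<bar>g x\<bar> / \<omega> x * \<omega> x" using elim by simp
    also have "\<dots> \<le> (\<bar>g x\<bar> / \<omega> x) powr q / q + \<omega> x powr p / p"
      using elim pq by (intro Youngs_inequality) auto
    also have "(\<bar>g x\<bar> / \<omega> x) powr q = \<bar>g x\<bar> powr q * \<omega> x powr (-q)"
      using elim by (simp add: powr_divide powr_minus_divide)
    finally show ?case by simp
  qed
qed

text \<open>The norm inequality of the embedding, raised to the power \<open>q\<close> and rewritten
  with nonnegative integrals.\<close>

lemma nn_integral_embedding_le:
  assumes "0 < q"
    and g: "g \<in> weighted_Lq \<Omega> q \<eta>" "g \<in> weighted_Lq \<Omega> q \<eta>'"
    and pos: "\<And>x. 0 \<le> \<eta> x" "\<And>x. 0 \<le> \<eta>' x"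
    and le: "weighted_Lq_norm \<Omega> q \<eta>' g \<le> C * weighted_Lq_norm \<Omega> q \<eta> g"
  shows "(\<integral>\<^sup>+x. ennreal (\<bar>g x\<bar> powr q * \<eta>' x) \<partial>lebesgue_on \<Omega>)
    \<le> ennreal (\<bar>C\<bar> powr q) * (\<integral>\<^sup>+x. ennreal (\<bar>g x\<bar> powr q * \<eta> x) \<partial>lebesgue_on \<Omega>)"
proof -
  have eq: "(\<integral>\<^sup>+x. ennreal (\<bar>g x\<bar> powr q * \<theta> x) \<partial>lebesgue_on \<Omega>) = ennreal (LINT x|lebesgue_on \<Omega>. \<bar>g x\<bar> powr q * \<theta> x)"
    "0 \<le> (LINT x|lebesgue_on \<Omega>. \<bar>g x\<bar> powr q * \<theta> x)"
    if "g \<in> weighted_Lq \<Omega> q \<theta>" "\<And>x. 0 \<le> \<theta> x" for \<theta>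
    using that by (auto simp: weighted_Lq_def intro!: nn_integral_eq_integral integral_nonneg_AE)
  note eq1 = eq[OF g(1) pos(1)] and eq2 = eq[OF g(2) pos(2)]
  show ?thesis
  proof (rule le_of_ennreal_rpow_inverse_le[OF assms(1)])
    show "ennreal_rpow (\<integral>\<^sup>+x. ennreal (\<bar>g x\<bar> powr q * \<eta>' x) \<partial>lebesgue_on \<Omega>) (1 / q)
      \<le> ennreal C * ennreal_rpow (\<integral>\<^sup>+x. ennreal (\<bar>g x\<bar> powr q * \<eta> x) \<partial>lebesgue_on \<Omega>) (1 / q)"
      using le by (simp add: eq1 eq2 ennreal_rpow_ennreal weighted_Lq_norm_def ennreal_leI flip: ennreal_mult'')
  qed (simp add: eq1)
qed

text \<open>Serves to show that the tree, whose vertex type is arbitrary, is countable: its vertices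
  other than the root index disjoint nonempty open sets.\<close>

lemma countable_disjoint_family_open:
  fixes B :: "'i \<Rightarrow> 'a::second_countable_topology set"
  assumes "disjoint_family_on B I" and "\<And>i. i \<in> I \<Longrightarrow> open (B i)" and "\<And>i. i \<in> I \<Longrightarrow> B i \<noteq> {}"
  shows "countable I"
proof -
  have "countable (B ` I)"
    using assms(2) disjoint_family_on_disjoint_image[OF assms(1)]
    by (intro countable_disjoint_open_subsets) auto
  moreover have "inj_on B I"
    using assms(1,3) unfolding inj_on_def disjoint_family_on_def by (metis inf.idem)
  ultimately show ?thesis by (rule countable_image_inj_on)
qed

lemma integral_lebesgue_on_subset:
  fixes f :: "'a::euclidean_space \<Rightarrow> real"
  assumes "open S" "open \<Omega>" "S \<subseteq> \<Omega>" and "\<And>x. x \<in> \<Omega> - S \<Longrightarrow> f x = 0"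
  shows "(LINT x|lebesgue_on S. f x) = (LINT x|lebesgue_on \<Omega>. f x)"
  using assms by (auto simp: integral_restrict_space indicator_def intro!: Bochner_Integration.integral_cong)

lemma nn_integral_lebesgue_on_subset:
  fixes f :: "'a::euclidean_space \<Rightarrow> ennreal"
  assumes "open S" "open \<Omega>" "S \<subseteq> \<Omega>"
  shows "(\<integral>\<^sup>+x. f x \<partial>lebesgue_on S) \<le> (\<integral>\<^sup>+x. f x \<partial>lebesgue_on \<Omega>)"
  using assms by (auto simp: nn_integral_restrict_space indicator_def intro!: nn_integral_mono)

text \<open>Since division by 0 yields 0, the bound on the ratio would also hold for an empty
  \<open>B t\<close>; nonemptiness is therefore stated separately. With extended nonnegative
  integrals on both sides, finiteness of the left-hand side is part of the claim.\<close>

theorem theorem3p8: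
  fixes p q :: real
    and \<Omega> :: "(real ^ 'n) set"
    and \<Gamma> :: "'t set" and E :: "'t \<Rightarrow> 't \<Rightarrow> bool" and a :: 't
    and U B :: "'t \<Rightarrow> (real ^ 'n) set"
    and \<nu> \<omega> :: "real ^ 'n \<Rightarrow> real"
  assumes "1 < p" and "1 < q" and "1 / p + 1 / q = 1"
    and "2 \<le> CARD('n)"
    and "open \<Omega>" and "connected \<Omega>" and "\<Omega> \<noteq> {}" and "bounded \<Omega>"
    and "tree_covering \<Omega> \<Gamma> E a U B"
    and "\<And>t. t \<in> \<Gamma> - {a} \<Longrightarrow> B t \<noteq> {}"
    and "\<exists>C::real. \<forall>t\<in>\<Gamma> - {a}. measure lebesgue (U t) / measure lebesgue (B t) \<le> C"
    and "admissible_weight \<Omega> \<Gamma> U \<nu>" and "admissible_weight \<Omega> \<Gamma> U \<omega>"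
    and "integrable (lebesgue_on \<Omega>) (\<lambda>x. \<omega> x powr p)"
    and "continuously_embedded_Lq \<Omega> q (\<lambda>x. \<omega> x powr (-q)) (\<lambda>x. \<nu> x powr (-q))"
    and "discrete_Hardy \<Gamma> E a q
           (\<lambda>t. measure lebesgue (B t) powr (- q / p) * real_of_ereal (ess_inf_on (B t) \<nu>) powr (-q))
           (\<lambda>t. measure lebesgue (B t) powr (- q / p) * real_of_ereal (ess_inf_on (B t) \<omega>) powr (-q))"
  shows "\<exists>C::real. \<forall>g \<in> weighted_Lq \<Omega> q (\<lambda>x. \<omega> x powr (-q)).
           (LINT x|lebesgue_on \<Omega>. g x) = 0 \<longrightarrow>
           (\<exists>h::'t \<Rightarrow> real ^ 'n \<Rightarrow> real.
              C_decomposition \<Omega> \<Gamma> U g h \<and>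
              (\<Sum>\<^sub>\<infinity>t\<in>\<Gamma>. \<integral>\<^sup>+x. ennreal (\<bar>h t x\<bar> powr q * \<nu> x powr (-q)) \<partial>lebesgue_on (U t))
              \<le> ennreal C * (\<integral>\<^sup>+x. ennreal (\<bar>g x\<bar> powr q * \<omega> x powr (-q)) \<partial>lebesgue_on \<Omega>))"
proof -
  note pq = assms(1-3) and \<Omega> = assms(5)
  let ?M = "lebesgue_on \<Omega>"
  let ?G = "\<lambda>g \<eta>. \<integral>\<^sup>+x. ennreal (\<bar>g x\<bar> powr q * \<eta> x powr (-q)) \<partial>?M"
  define \<omega>i where "\<omega>i t = real_of_ereal (ess_inf_on (B t) \<omega>)" for t
  define \<nu>i where "\<nu>i t = real_of_ereal (ess_inf_on (B t) \<nu>)" for t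
  have oc: "open_covering \<Omega> \<Gamma> U" and tree: "rooted_tree \<Gamma> E a"
    and disj: "disjoint_family_on B (\<Gamma> - {a})"
    and B: "\<And>t. t \<in> \<Gamma> - {a} \<Longrightarrow> open (B t) \<and> B t \<subseteq> U t \<inter> U (tree_parent \<Gamma> E a t)"
    using assms(9) by (auto simp: tree_covering_def)
  have U: "open (U t)" "U t \<subseteq> \<Omega>" if "t \<in> \<Gamma>" for t
    using oc that by (auto simp: open_covering_def)
  have Bne: "B t \<noteq> {}" if "t \<in> \<Gamma> - {a}" for t using assms(10) that .
  have cnt: "countable \<Gamma>"
    using countable_disjoint_family_open[OF disj] B Bne by simp
  have B\<Omega>: "B t \<subseteq> \<Omega>" if "t \<in> \<Gamma> - {a}" for t using B[OF that] U that by blast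
  have sets: "S \<in> sets ?M" if "open S" "S \<subseteq> \<Omega>" for S
    using that \<Omega> by (simp add: sets_restrict_space_iff)
  have meas: "measure ?M S = measure lebesgue S" if "open S" "S \<subseteq> \<Omega>" for S
    using that \<Omega> by (intro measure_restrict_space) auto
  have lm: "S \<in> lmeasurable" if "open S" "S \<subseteq> \<Omega>" for S
    using that assms(8) bounded_subset by (intro lmeasurable_open) auto
  have mpos: "0 < measure lebesgue S" if "open S" "S \<subseteq> \<Omega>" "S \<noteq> {}" for S
    using open_not_negligible[OF that(1,3)] lm[OF that(1,2)]
    by (simp add: negligible_iff_measure zero_less_measure_iff)
  have US: "U t \<in> sets ?M" if "t \<in> \<Gamma>" for t by (rule sets[OF U[OF that]])
  obtain X where "(\<forall>t\<in>\<Gamma>. X t \<in> sets ?M \<and> X t \<subseteq> U t) \<and> disjoint_family_on X \<Gamma>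
      \<and> (\<Union>t\<in>\<Gamma>. X t) = (\<Union>t\<in>\<Gamma>. U t)"
    by (rule exE[OF disjoint_refinement[of \<Gamma> U ?M, OF cnt US]])
  then have X: "\<And>t. t \<in> \<Gamma> \<Longrightarrow> X t \<in> sets ?M" "\<And>t. t \<in> \<Gamma> \<Longrightarrow> X t \<subseteq> U t"
    "disjoint_family_on X \<Gamma>" "(\<Union>t\<in>\<Gamma>. X t) = (\<Union>t\<in>\<Gamma>. U t)" by simp_all
  have "AE x in lebesgue. x \<in> \<Omega> \<longrightarrow> x \<in> (\<Union>t\<in>\<Gamma>. U t)"
    by (rule AE_I'[of "\<Omega> - (\<Union>t\<in>\<Gamma>. U t)"]) (use oc in \<open>auto simp: open_covering_def\<close>)
  then have cover: "AE x in ?M. x \<in> (\<Union>t\<in>\<Gamma>. X t)"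
    unfolding X(4) using \<Omega> by (subst AE_restrict_space_iff) auto
  interpret tree_partition ?M \<Gamma> E a U B X
  proof
    fix t assume t: "t \<in> \<Gamma> - {a}"
    show "B t \<in> sets ?M" "B t \<subseteq> U t \<inter> U (tree_parent \<Gamma> E a t)"
      using B[OF t] sets B\<Omega>[OF t] by auto
    show "0 < measure ?M (B t)"
      using B[OF t] B\<Omega>[OF t] Bne[OF t] meas[of "B t"] mpos[of "B t"] by metis
  qed (fact tree cnt disj X cover)+
  have \<nu>i: "0 < \<nu>i t" "AE x in ?M. x \<in> B t \<longrightarrow> \<nu>i t \<le> \<nu> x" if "t \<in> \<Gamma> - {a}" for t
    using admissible_weight_bounds[OF \<Omega> oc assms(12)] B[OF that] Bne[OF that] that
    unfolding \<nu>i_def by (meson DiffD1 le_infE)+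
  \<comment> \<open>The bound on \<open>\<omega>\<close> is wanted on all of \<open>U t\<close>,
    where \<open>X t\<close> lies, but in terms of the infimum over \<open>B t\<close> that occurs
    in the Hardy inequality.\<close>
  obtain K where K: "K > 0 \<and> (\<forall>t\<in>\<Gamma>. \<forall>S. open S \<longrightarrow> S \<noteq> {} \<longrightarrow> S \<subseteq> U t \<longrightarrow>
      0 < real_of_ereal (ess_inf_on S \<omega>) \<and>
      (AE x in ?M. x \<in> S \<longrightarrow> real_of_ereal (ess_inf_on S \<omega>) \<le> \<omega> x) \<and>
      (AE x in ?M. x \<in> U t \<longrightarrow> \<omega> x \<le> K * real_of_ereal (ess_inf_on S \<omega>)))"
    by (rule exE[OF admissible_weight_bounds[OF \<Omega> oc assms(13)]])
  then have K0: "0 < K" by simp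
  have \<omega>i: "0 < \<omega>i t" "AE x in ?M. x \<in> U t \<longrightarrow> \<omega> x \<le> K * \<omega>i t" if "t \<in> \<Gamma> - {a}" for t
    using K B[OF that] Bne[OF that] that unfolding \<omega>i_def by (meson DiffD1 le_infE)+
  have \<omega>pos: "AE x in ?M. 0 < \<omega> x"
    and [measurable]: "\<omega> \<in> borel_measurable ?M" "\<nu> \<in> borel_measurable ?M"
    using assms(12,13) by (auto simp: admissible_weight_def weight_on_def)
  obtain CU where CU: "\<And>t. t \<in> \<Gamma> - {a} \<Longrightarrow> measure lebesgue (U t) / measure lebesgue (B t) \<le> CU"
    using assms(11) by blast
  obtain CE where CE: "\<And>g. g \<in> weighted_Lq \<Omega> q (\<lambda>x. \<omega> x powr (-q)) \<Longrightarrow>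
      g \<in> weighted_Lq \<Omega> q (\<lambda>x. \<nu> x powr (-q)) \<and>
      weighted_Lq_norm \<Omega> q (\<lambda>x. \<nu> x powr (-q)) g \<le> CE * weighted_Lq_norm \<Omega> q (\<lambda>x. \<omega> x powr (-q)) g"
    using assms(15) unfolding continuously_embedded_Lq_def by blast
  obtain CH where CH: "\<And>b. (\<forall>t\<in>\<Gamma> - {a}. 0 \<le> b t) \<Longrightarrow>
      ennreal_rpow (\<Sum>\<^sub>\<infinity>t\<in>\<Gamma> - {a}. ennreal (measure lebesgue (B t) powr (- q / p) * \<nu>i t powr (-q)) *
        ennreal_rpow (\<Sum>\<^sub>\<infinity>s\<in>subtree \<Gamma> E a t. ennreal (b s)) q) (1 / q)
      \<le> ennreal CH * ennreal_rpow (\<Sum>\<^sub>\<infinity>t\<in>\<Gamma> - {a}.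
        ennreal (measure lebesgue (B t) powr (- q / p) * \<omega>i t powr (-q)) * ennreal_rpow (ennreal (b t)) q) (1 / q)"
    using assms(16) unfolding discrete_Hardy_def subtree_def \<nu>i_def \<omega>i_def by blast
  \<comment> \<open>The power of \<open>|B t|\<close> in the norm of a bump is the one in the Hardy
    inequality.\<close>
  have expo: "1 - q = - q / p" using pq by (auto simp: field_simps)
  define K1 where "K1 = CU powr (q / p) * K powr q"
  \<comment> \<open>The factor \<open>2 powr q\<close> comes from splitting a piece,
    \<open>CE\<close> from embedding \<open>g\<close> itself, the inner 2 from charging each bump
    twice, \<open>CH\<close> from the Hardy inequality and \<open>K1\<close> from Hoelder's
    inequality.\<close>
  define C where "C = 2 powr q * (\<bar>CE\<bar> powr q + 2 * (\<bar>CH\<bar> powr q * K1))"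
  show ?thesis
  proof (intro exI[of _ C] ballI impI)
    fix g assume gL: "g \<in> weighted_Lq \<Omega> q (\<lambda>x. \<omega> x powr (-q))" and g0: "(LINT x|?M. g x) = 0"
    have g: "integrable ?M g"
      by (rule integrable_of_weighted_Lq[OF pq \<omega>pos assms(14) gL])
    have [measurable]: "g \<in> borel_measurable ?M" using g by simp
    have gq: "integrable ?M (\<lambda>x. \<bar>g x\<bar> powr q * \<omega> x powr (-q))"
      using gL by (simp add: weighted_Lq_def)
    have Gfin: "?G g \<omega> < \<infinity>"
      using nn_integral_eq_integral[OF gq] by simp
    have G\<nu>: "?G g \<nu> \<le> ennreal (\<bar>CE\<bar> powr q) * ?G g \<omega>"
      using pq CE[OF gL] gL by (intro nn_integral_embedding_le) auto
    \<comment> \<open>The sequence to be inserted into the Hardy inequality: the mass of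
      \<open>|g|\<close> on each part.\<close>
    define b where "b t = (LINT x|?M. indicator (X t) x * \<bar>g x\<bar>)" for t
    have b0: "0 \<le> b t" for t unfolding b_def by (intro integral_nonneg_AE) auto
    have bound: "measure lebesgue (B t) powr (- q / p) * \<omega>i t powr (-q) * b t powr q
        \<le> K1 * (LINT x|?M. indicator (X t) x * (\<bar>g x\<bar> powr q * \<omega> x powr (-q)))"
      if t: "t \<in> \<Gamma> - {a}" for t
      unfolding b_def K1_def
    proof (rule weighted_average_powr_le[OF pq, where V = "measure lebesgue (U t)"])
      have t': "t \<in> \<Gamma>" using t by simp
      show "X t \<in> sets ?M" by (rule X(1)[OF t'])
      have "emeasure ?M (X t) \<le> emeasure ?M (U t)"
        by (intro emeasure_mono X(2)[OF t'] sets U[OF t'])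
      also have "\<dots> = ennreal (measure lebesgue (U t))"
        using U[OF t'] \<Omega> lm[OF U[OF t']] by (simp add: emeasure_restrict_space emeasure_eq_measure2)
      finally show "emeasure ?M (X t) \<le> ennreal (measure lebesgue (U t))" .
      show "0 < measure lebesgue (U t)"
        using U[OF t'] B[OF t] Bne[OF t] by (intro mpos) auto
      show "0 < measure lebesgue (B t)"
        using B[OF t] Bne[OF t] B\<Omega>[OF t] by (intro mpos) auto
      show "AE x in ?M. x \<in> X t \<longrightarrow> 0 < \<omega> x \<and> \<omega> x \<le> K * \<omega>i t"
        using \<omega>pos \<omega>i(2)[OF t] by eventually_elim (use X(2)[OF t'] in auto)
    qed (use CU[OF t] K0 \<omega>i(1)[OF t] g gq in auto)
    let ?W = "\<lambda>t. measure lebesgue (B t) powr (- q / p) * \<nu>i t powr (-q)"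
    have "(\<Sum>\<^sub>\<infinity>t\<in>\<Gamma> - {a}. ennreal (measure lebesgue (B t) powr (- q / p) * \<omega>i t powr (-q)) * ennreal_rpow (ennreal (b t)) q)
        \<le> (\<Sum>\<^sub>\<infinity>t\<in>\<Gamma>. ennreal K1 * (\<integral>\<^sup>+x. ennreal (\<bar>g x\<bar> powr q * \<omega> x powr (-q)) * indicator (X t) x \<partial>?M))"
    \<comment> \<open>The target sum gains the nonnegative term of the root; over all of
      \<open>\<Gamma>\<close> it then becomes one integral over the union of the sets
      \<open>X t\<close>.\<close>
    proof (rule infsum_mono_neutral)
      fix t assume "t \<in> (\<Gamma> - {a}) \<inter> \<Gamma>"
      then have t: "t \<in> \<Gamma> - {a}" and t': "t \<in> \<Gamma>" by auto
      have "ennreal (measure lebesgue (B t) powr (- q / p) * \<omega>i t powr (-q)) * ennreal_rpow (ennreal (b t)) q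
          = ennreal (measure lebesgue (B t) powr (- q / p) * \<omega>i t powr (-q) * b t powr q)"
        by (simp add: ennreal_rpow_ennreal b0 ennreal_mult)
      also have "\<dots> \<le> ennreal (K1 * (LINT x|?M. indicator (X t) x * (\<bar>g x\<bar> powr q * \<omega> x powr (-q))))"
        by (rule ennreal_leI[OF bound[OF t]])
      also have "\<dots> = ennreal K1 * ennreal (LINT x|?M. indicator (X t) x * (\<bar>g x\<bar> powr q * \<omega> x powr (-q)))"
        by (simp add: ennreal_mult' K1_def)
      also have "ennreal (LINT x|?M. indicator (X t) x * (\<bar>g x\<bar> powr q * \<omega> x powr (-q)))
          = (\<integral>\<^sup>+x. ennreal (indicator (X t) x * (\<bar>g x\<bar> powr q * \<omega> x powr (-q))) \<partial>?M)"
        using integrable_mult_indicator[OF X(1)[OF t'] gq]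
        by (intro nn_integral_eq_integral[symmetric]) auto
      also have "\<dots> = (\<integral>\<^sup>+x. ennreal (\<bar>g x\<bar> powr q * \<omega> x powr (-q)) * indicator (X t) x \<partial>?M)"
        by (intro nn_integral_cong) (auto simp: indicator_def)
      finally show "ennreal (measure lebesgue (B t) powr (- q / p) * \<omega>i t powr (-q)) * ennreal_rpow (ennreal (b t)) q
          \<le> ennreal K1 * (\<integral>\<^sup>+x. ennreal (\<bar>g x\<bar> powr q * \<omega> x powr (-q)) * indicator (X t) x \<partial>?M)" .
    qed (auto simp: nonneg_summable_on_complete)
    also have "\<dots> = ennreal K1 * (\<Sum>\<^sub>\<infinity>t\<in>\<Gamma>. \<integral>\<^sup>+x. ennreal (\<bar>g x\<bar> powr q * \<omega> x powr (-q)) * indicator (X t) x \<partial>?M)"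
      by (simp add: nn_integral_cmult flip: nn_integral_count_space_eq_infsum[OF cnt])
    also have "(\<Sum>\<^sub>\<infinity>t\<in>\<Gamma>. \<integral>\<^sup>+x. ennreal (\<bar>g x\<bar> powr q * \<omega> x powr (-q)) * indicator (X t) x \<partial>?M)
        = (\<integral>\<^sup>+x. ennreal (\<bar>g x\<bar> powr q * \<omega> x powr (-q)) * indicator (\<Union>t\<in>\<Gamma>. X t) x \<partial>?M)"
      using X cnt by (intro nn_integral_UN_eq_infsum[symmetric]) auto
    also have "ennreal K1 * \<dots> \<le> ennreal K1 * ?G g \<omega>"
      by (intro mult_left_mono nn_integral_mono) (auto simp: indicator_def)
    finally have rhs: "(\<Sum>\<^sub>\<infinity>t\<in>\<Gamma> - {a}. ennreal (measure lebesgue (B t) powr (- q / p) * \<omega>i t powr (-q)) * ennreal_rpow (ennreal (b t)) q)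
        \<le> ennreal K1 * ?G g \<omega>" (is "?R \<le> _") .
    \<comment> \<open>Finiteness of the right-hand side is what allows the outer roots in the Hardy
      inequality to be removed.\<close>
    have "?R < \<infinity>" using rhs Gfin by (auto simp: ennreal_mult_less_top intro: le_less_trans)
    then have hardy: "(\<Sum>\<^sub>\<infinity>t\<in>\<Gamma> - {a}. ennreal (?W t) * ennreal_rpow (\<Sum>\<^sub>\<infinity>s\<in>subtree \<Gamma> E a t. ennreal (b s)) q)
        \<le> ennreal (\<bar>CH\<bar> powr q) * ?R"
      using pq b0 by (intro le_of_ennreal_rpow_inverse_le CH) auto
    have mass: "(\<Sum>\<^sub>\<infinity>t\<in>\<Gamma> - {a}. ennreal (measure ?M (B t) powr (1 - q) * \<nu>i t powr (-q) * \<bar>subtree_integral g t\<bar> powr q))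
        \<le> (\<Sum>\<^sub>\<infinity>t\<in>\<Gamma> - {a}. ennreal (?W t) * ennreal_rpow (\<Sum>\<^sub>\<infinity>s\<in>subtree \<Gamma> E a t. ennreal (b s)) q)"
    proof (rule infsum_mono)
      fix t assume t: "t \<in> \<Gamma> - {a}"
      have "ennreal (measure ?M (B t) powr (1 - q) * \<nu>i t powr (-q) * \<bar>subtree_integral g t\<bar> powr q)
          = ennreal (?W t) * ennreal_rpow (ennreal \<bar>subtree_integral g t\<bar>) q"
        using meas[of "B t"] B[OF t] B\<Omega>[OF t] by (simp add: expo ennreal_rpow_ennreal ennreal_mult)
      also have "\<dots> \<le> ennreal (?W t) * ennreal_rpow (\<Sum>\<^sub>\<infinity>s\<in>subtree \<Gamma> E a t. ennreal (b s)) q"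
        using ennreal_subtree_integral_le[OF g, of t] pq
        by (intro mult_left_mono ennreal_rpow_mono) (auto simp: b_def)
      finally show "ennreal (measure ?M (B t) powr (1 - q) * \<nu>i t powr (-q) * \<bar>subtree_integral g t\<bar> powr q)
          \<le> ennreal (?W t) * ennreal_rpow (\<Sum>\<^sub>\<infinity>s\<in>subtree \<Gamma> E a t. ennreal (b s)) q" .
    qed (auto simp: nonneg_summable_on_complete)
    let ?v = "\<lambda>x. ennreal (\<nu> x powr (-q))"
    have "(\<Sum>\<^sub>\<infinity>t\<in>\<Gamma>. \<integral>\<^sup>+x. ennreal (\<bar>piece g t x\<bar> powr q * \<nu> x powr (-q)) \<partial>lebesgue_on (U t))
        \<le> (\<Sum>\<^sub>\<infinity>t\<in>\<Gamma>. \<integral>\<^sup>+x. ennreal (\<bar>piece g t x\<bar> powr q) * ?v x \<partial>?M)"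
      using nn_integral_lebesgue_on_subset[OF U(1) \<Omega> U(2)]
      by (intro infsum_mono) (auto simp: nonneg_summable_on_complete simp flip: ennreal_mult)
    also have "\<dots> \<le> ennreal (2 powr q) * ((\<integral>\<^sup>+x. ennreal (\<bar>g x\<bar> powr q) * ?v x \<partial>?M)
      + 2 * (\<Sum>\<^sub>\<infinity>t\<in>\<Gamma> - {a}. ennreal (measure ?M (B t) powr (1 - q) * \<nu>i t powr (-q) * \<bar>subtree_integral g t\<bar> powr q)))"
    proof (rule infsum_nn_integral_pieces_le[OF _ g])
      fix t assume t: "t \<in> \<Gamma> - {a}"
      \<comment> \<open>The exponent is negative, so the lower bound \<open>\<nu>i t\<close> on
        \<open>\<nu>\<close> becomes an upper bound on the weight.\<close>
      show "AE x in ?M. x \<in> B t \<longrightarrow> ?v x \<le> ennreal (\<nu>i t powr (-q))"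
        using \<nu>i(2)[OF t] by eventually_elim
          (use \<nu>i(1)[OF t] pq in \<open>auto intro!: ennreal_leI powr_mono2'\<close>)
    qed (use pq in auto)
    also have "(\<integral>\<^sup>+x. ennreal (\<bar>g x\<bar> powr q) * ?v x \<partial>?M) = ?G g \<nu>"
      by (simp add: ennreal_mult)
    also have "ennreal (2 powr q) * (?G g \<nu> + 2 * (\<Sum>\<^sub>\<infinity>t\<in>\<Gamma> - {a}. ennreal (measure ?M (B t) powr (1 - q) * \<nu>i t powr (-q) * \<bar>subtree_integral g t\<bar> powr q)))
        \<le> ennreal (2 powr q) * (ennreal (\<bar>CE\<bar> powr q) * ?G g \<omega> + 2 * (ennreal (\<bar>CH\<bar> powr q) * (ennreal K1 * ?G g \<omega>)))"
      by (intro mult_left_mono add_mono G\<nu> order_trans[OF mass] order_trans[OF hardy] rhs) auto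
    also have "\<dots> = ennreal C * ?G g \<omega>"
      by (simp add: C_def K1_def ennreal_mult ennreal_plus distrib_left distrib_right mult_ac)
    finally have main: "(\<Sum>\<^sub>\<infinity>t\<in>\<Gamma>. \<integral>\<^sup>+x. ennreal (\<bar>piece g t x\<bar> powr q * \<nu> x powr (-q)) \<partial>lebesgue_on (U t))
        \<le> ennreal C * ?G g \<omega>" .
    have "C_decomposition \<Omega> \<Gamma> U g (piece g)"
      unfolding C_decomposition_def
    proof (intro conjI ballI)
      fix t assume t: "t \<in> \<Gamma>"
      show "integrable ?M (piece g t)" by (rule integrable_piece[OF t g])
      show "AE x in ?M. x \<notin> U t \<longrightarrow> piece g t x = 0" using piece_outside[OF t] by simp
      show "(LINT x|lebesgue_on (U t). piece g t x) = 0"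
        using integral_lebesgue_on_subset[OF U(1)[OF t] \<Omega> U(2)[OF t], of "piece g t"]
          piece_outside[OF t] integral_piece[OF t g g0] by simp
    qed (rule has_sum_piece)
    with main show "\<exists>h. C_decomposition \<Omega> \<Gamma> U g h \<and>
        (\<Sum>\<^sub>\<infinity>t\<in>\<Gamma>. \<integral>\<^sup>+x. ennreal (\<bar>h t x\<bar> powr q * \<nu> x powr (-q)) \<partial>lebesgue_on (U t)) \<le> ennreal C * ?G g \<omega>"
      by blast
  qed
qed

end
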